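(* Let $X$ be a complex Banach space, let $T\in L(X)$ and let $\mathcal C\subset X$ be a $\mathbb C$-cone of $K$-bounded sectional aperture (for some $1\le K<+\infty$) which is $T^{n_0}$-inner regular for some integer $n_0\ge0$. Suppose that $T$ is a strict cone-contraction, i.e. $T(\mathcal C^* )\subset\mathcal C^*$ with $\Delta=\operatorname{diam}_{\mathcal C}T(\mathcal C^* )<\infty$. Then $T$ has a spectral gap.
   Context: For a subset $S$ of a vector space, $S^*=S\setminus\{0\}$. $L(X)$ denotes bounded linear operators on $X$. A $\mathbb C$-cone in $X$ is a closed subset $\mathcal C$ which is $\mathbb C$-invariant ($\mathbb C\,\mathcal C=\mathcal C$), contains at least one complex line, and contains no complex planes (if $x,y$ are linearly independent then $\operatorname{Span}\{x,y\}\not\subset\mathcal C$, spans being complex). Gauge: for $x,y\in\mathcal C^*$ put $D(x,y)=\{\lambda\in\widehat{\mathbb C}:(1+\lambda)x+(1-\lambda)y\in\mathcal C\}$, with $\infty\in D(x,y)$ iff $x-y\in\mathcal C$, and let $D^o(x,y)$ be its interior in the Riemann sphere $\widehat{\mathbb C}$. If $x,y$ are co-linear, $d_{\mathcal C}(x,y)=0$. If they are independent and $-1,1$ lie in the same connected component $U$ of $D^o(x,y)$, then $d_{\mathcal C}(x,y)=d_U(-1,1)$, the hyperbolic distance in $U$ (normalized by $ds=2|dz|/(1-|z|^2)$ on the unit disk). Otherwise $d_{\mathcal C}(x,y)=+\infty$. $\operatorname{diam}_{\mathcal C}(A)=\sup_{x,y\in A}d_{\mathcal C}(x,y)$. $\mathcal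 C$ has $K$-bounded sectional aperture if for every $x,y\in X$ there is a non-zero linear functional $m$ on $\operatorname{Span}\{x,y\}$ with $|\langle m,u\rangle|\ge\frac1K\|u\|\,\|m\|$ for all $u\in\operatorname{Span}\{x,y\}\cap\mathcal C$. $\mathcal C$ is $T^{n_0}$-inner regular if there are $r>0$ and $x_0\in\mathcal C$ such that $x_0+T^{n_0}B(0,r)\subset\mathcal C^*$. A bounded operator has a spectral gap if it has a simple isolated eigenvalue whose modulus equals the spectral radius $r_{\rm sp}$ and the remaining part of the spectrum is contained in a disk centered at $0$ of radius strictly smaller than $r_{\rm sp}$. *)

theory Defs
  imports "HOL-Complex_Analysis.Complex_Analysis"
begin

section \<open>Complex Banach spaces and bounded linear operators\<close>

class complex_normed_vector = real_normed_vector +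
  fixes scaleC :: "complex \<Rightarrow> 'a \<Rightarrow> 'a"  (infixr \<open>*\<^sub>C\<close> 75)
  assumes scaleC_add_right: "a *\<^sub>C (x + y) = a *\<^sub>C x + a *\<^sub>C y"
    and scaleC_add_left: "(a + b) *\<^sub>C x = a *\<^sub>C x + b *\<^sub>C x"
    and scaleC_scaleC: "a *\<^sub>C b *\<^sub>C x = (a * b) *\<^sub>C x"
    and scaleC_of_real: "complex_of_real r *\<^sub>C x = r *\<^sub>R x"
    and norm_scaleC: "norm (a *\<^sub>C x) = cmod a * norm x"

class complex_banach = complex_normed_vector + banach

instantiation complex :: complex_banach
begin
definition scaleC_complex_def: "scaleC = ((*) :: complex \<Rightarrow> complex \<Rightarrow> complex)"
instance
  by standard (auto simp: scaleC_complex_def algebra_simps norm_mult scaleR_conv_of_real)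
end

global_interpretation complex_vector:
  vector_space "scaleC :: complex \<Rightarrow> 'a \<Rightarrow> 'a :: complex_normed_vector"
  defines cdependent = complex_vector.dependent
    and cspan = complex_vector.span
    and cdim = complex_vector.dim
proof
  show "1 *\<^sub>C x = x" for x :: 'a
    using scaleC_of_real[of 1 x] by simp
qed (simp_all add: scaleC_add_right scaleC_add_left scaleC_scaleC)

text \<open>The condition \<open>x \<noteq> y\<close> is needed because \<open>{x, x}\<close> is a singleton.\<close>
definition independent_pair :: "'a::complex_normed_vector \<Rightarrow> 'a \<Rightarrow> bool" where
  "independent_pair x y \<longleftrightarrow> x \<noteq> y \<and> \<not> cdependent {x, y}"

definition bounded_clinear :: "('a::complex_normed_vector \<Rightarrow> 'b::complex_normed_vector) \<Rightarrow> bool" where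
  "bounded_clinear T \<longleftrightarrow>
     Vector_Spaces.linear scaleC scaleC T \<and> (\<exists>B. \<forall>x. norm (T x) \<le> norm x * B)"


section \<open>The Riemann sphere\<close>

datatype riemann_sphere = Fin complex | Infty

text \<open>The topology of the one-point compactification of the complex plane.\<close>
instantiation riemann_sphere :: topological_space
begin
definition open_riemann_sphere :: "riemann_sphere set \<Rightarrow> bool" where
  "open_riemann_sphere S \<longleftrightarrow>
     open (Fin -` S) \<and> (Infty \<in> S \<longrightarrow> compact (- (Fin -` S)))"
instance
proof
  show "open (UNIV :: riemann_sphere set)"
    by (simp add: open_riemann_sphere_def)
next
  fix S T :: "riemann_sphere set"
  assume "open S" "open T"
  then show "open (S \<inter> T)"
    by (auto simp: open_riemann_sphere_def open_Int vimage_Int Compl_Int compact_Un)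
next
  fix K :: "riemann_sphere set set"
  assume K: "\<forall>S\<in>K. open S"
  have op: "open (Fin -` \<Union>K)"
    using K by (auto simp: open_riemann_sphere_def vimage_Union)
  have "compact (- (Fin -` \<Union>K))" if "Infty \<in> \<Union>K"
  proof -
    from that obtain S where S: "S \<in> K" "Infty \<in> S" by auto
    then have "compact (- (Fin -` S))"
      using K by (auto simp: open_riemann_sphere_def)
    moreover have "- (Fin -` \<Union>K) = - (Fin -` S) \<inter> - (Fin -` \<Union>K)"
      using S by auto
    moreover have "closed (- (Fin -` \<Union>K))"
      using op by (simp add: closed_Compl)
    ultimately show ?thesis
      by (metis compact_Int_closed)
  qed
  with op show "open (\<Union>K)"
    by (simp add: open_riemann_sphere_def)
qed
end

text \<open>
  The two standard charts \<open>w \<mapsto> w\<close> and \<open>w \<mapsto> 1/w\<close>; their values at \<^term>\<open>Infty\<close> and at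
  \<^term>\<open>Fin 0\<close>, respectively, are irrelevant.
\<close>
primrec chart_0 :: "riemann_sphere \<Rightarrow> complex" where
  "chart_0 (Fin w) = w"
| "chart_0 Infty = 0"

primrec chart_Infty :: "riemann_sphere \<Rightarrow> complex" where
  "chart_Infty (Fin w) = inverse w"
| "chart_Infty Infty = 0"

definition sphere_holomorphic_on :: "(complex \<Rightarrow> riemann_sphere) \<Rightarrow> complex set \<Rightarrow> bool" where
  "sphere_holomorphic_on f S \<longleftrightarrow>
     continuous_on S f \<and>
     (chart_0 \<circ> f) holomorphic_on {z \<in> S. f z \<noteq> Infty} \<and>
     (chart_Infty \<circ> f) holomorphic_on {z \<in> S. f z \<noteq> Fin 0}"


section \<open>The hyperbolic distance\<close>

text \<open>
  Length of a path in the unit disk for \<open>ds = 2 |dz| / (1 - |z|\<^sup>2)\<close>. The integral takes values in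
  \<open>[0, \<infinity>]\<close> because the derivative of a piecewise \<open>C\<^sup>1\<close> path in the sense of
  \<^const>\<open>valid_path\<close> need not be integrable near an exceptional point.
\<close>
definition disk_length :: "(real \<Rightarrow> complex) \<Rightarrow> ennreal" where
  "disk_length \<gamma> =
     (\<integral>\<^sup>+t\<in>{0..1}. ennreal (2 * cmod (vector_derivative \<gamma> (at t)) / (1 - (cmod (\<gamma> t))\<^sup>2)) \<partial>lborel)"

definition holomorphic_disk_covering :: "(complex \<Rightarrow> riemann_sphere) \<Rightarrow> riemann_sphere set \<Rightarrow> bool" where
  "holomorphic_disk_covering \<pi> U \<longleftrightarrow>
     sphere_holomorphic_on \<pi> (ball 0 1) \<and> covering_space (ball 0 1) \<pi> U"

text \<open>
  The hyperbolic metric of a domain \<open>U\<close> is the push-forward of the metric of the disk under the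
  holomorphic universal covering \<open>\<pi>\<close>, so the length of a path in \<open>U\<close> is the length of any of
  its lifts to the disk. The covering is unique up to automorphisms of the disk, which are isometries;
  hence the choice of \<open>\<pi>\<close> does not matter. By uniformization \<open>\<pi>\<close> exists exactly when \<open>U\<close> is a
  domain omitting at least three points of the sphere.
\<close>
definition hyperbolic_dist ::
    "riemann_sphere set \<Rightarrow> riemann_sphere \<Rightarrow> riemann_sphere \<Rightarrow> ennreal" where
  "hyperbolic_dist U a b =
     Inf {disk_length \<gamma> | \<pi> \<gamma>. holomorphic_disk_covering \<pi> U \<and> valid_path \<gamma> \<and>
            path_image \<gamma> \<subseteq> ball 0 1 \<and> \<pi> (pathstart \<gamma>) = a \<and> \<pi> (pathfinish \<gamma>) = b}"


section \<open>Complex cones and the projective gauge\<close>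

definition C_cone :: "'a::complex_normed_vector set \<Rightarrow> bool" where
  "C_cone C \<longleftrightarrow>
     closed C \<and>
     {c *\<^sub>C x | c x. x \<in> C} = C \<and>
     (\<exists>x. x \<noteq> 0 \<and> cspan {x} \<subseteq> C) \<and>
     (\<forall>x y. independent_pair x y \<longrightarrow> \<not> cspan {x, y} \<subseteq> C)"

definition gauge_set :: "'a::complex_normed_vector set \<Rightarrow> 'a \<Rightarrow> 'a \<Rightarrow> riemann_sphere set" where
  "gauge_set C x y =
     {p. case p of Fin l \<Rightarrow> (1 + l) *\<^sub>C x + (1 - l) *\<^sub>C y \<in> C | Infty \<Rightarrow> x - y \<in> C}"

definition cone_dist :: "'a::complex_normed_vector set \<Rightarrow> 'a \<Rightarrow> 'a \<Rightarrow> ennreal" where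
  "cone_dist C x y =
     (let U = connected_component_set (interior (gauge_set C x y)) (Fin (-1)) in
      if \<not> independent_pair x y then 0
      else if Fin 1 \<in> U then hyperbolic_dist U (Fin (-1)) (Fin 1)
      else \<infinity>)"

definition cone_diam :: "'a::complex_normed_vector set \<Rightarrow> 'a set \<Rightarrow> ennreal" where
  "cone_diam C A = (SUP x\<in>A. SUP y\<in>A. cone_dist C x y)"

definition functional_on :: "'a::complex_normed_vector set \<Rightarrow> ('a \<Rightarrow> complex) \<Rightarrow> bool" where
  "functional_on S m \<longleftrightarrow>
     (\<forall>u\<in>S. \<forall>v\<in>S. m (u + v) = m u + m v) \<and> (\<forall>c. \<forall>u\<in>S. m (c *\<^sub>C u) = c * m u)"

text \<open>As in \<^const>\<open>onorm\<close>; \<open>u = 0\<close> contributes \<open>0\<close>.\<close>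
definition functional_norm :: "'a::complex_normed_vector set \<Rightarrow> ('a \<Rightarrow> complex) \<Rightarrow> real" where
  "functional_norm S m = (SUP u\<in>S. cmod (m u) / norm u)"

text \<open>
  The pair \<open>x = y = 0\<close> is left out, because its span carries no non-zero functional.
\<close>
definition bounded_sectional_aperture :: "real \<Rightarrow> 'a::complex_normed_vector set \<Rightarrow> bool" where
  "bounded_sectional_aperture K C \<longleftrightarrow>
     (\<forall>x y. \<not> (x = 0 \<and> y = 0) \<longrightarrow>
        (\<exists>m. functional_on (cspan {x, y}) m \<and> (\<exists>u\<in>cspan {x, y}. m u \<noteq> 0) \<and>
             (\<forall>u \<in> cspan {x, y} \<inter> C.
                cmod (m u) \<ge> 1 / K * norm u * functional_norm (cspan {x, y}) m)))"

definition inner_regular :: "('a::complex_normed_vector \<Rightarrow> 'a) \<Rightarrow> nat \<Rightarrow> 'a set \<Rightarrow> bool" where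
  "inner_regular T n C \<longleftrightarrow>
     (\<exists>r>0. \<exists>x0\<in>C. (\<lambda>h. x0 + (T ^^ n) h) ` ball 0 r \<subseteq> C - {0})"

definition strict_cone_contraction :: "('a::complex_normed_vector \<Rightarrow> 'a) \<Rightarrow> 'a set \<Rightarrow> bool" where
  "strict_cone_contraction T C \<longleftrightarrow>
     T ` (C - {0}) \<subseteq> C - {0} \<and> cone_diam C (T ` (C - {0})) < \<infinity>"


section \<open>Spectrum and spectral gap\<close>

definition resolvent_set :: "('a::complex_normed_vector \<Rightarrow> 'a) \<Rightarrow> complex set" where
  "resolvent_set T =
     {z. bij (\<lambda>x. z *\<^sub>C x - T x) \<and> bounded_clinear (inv (\<lambda>x. z *\<^sub>C x - T x))}"

definition resolvent :: "('a::complex_normed_vector \<Rightarrow> 'a) \<Rightarrow> complex \<Rightarrow> 'a \<Rightarrow> 'a" where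
  "resolvent T z = inv (\<lambda>x. z *\<^sub>C x - T x)"

definition spectrum :: "('a::complex_normed_vector \<Rightarrow> 'a) \<Rightarrow> complex set" where
  "spectrum T = - resolvent_set T"

definition spectral_radius :: "('a::complex_normed_vector \<Rightarrow> 'a) \<Rightarrow> real" where
  "spectral_radius T = (SUP z\<in>spectrum T. cmod z)"

text \<open>
  The Riesz projection \<open>1/(2\<pi>i) \<integral> (z - T)\<^sup>-\<^sup>1 dz\<close> along the circle of radius \<open>\<epsilon>\<close> about \<open>l\<close>,
  evaluated pointwise; the contour integral is written out because the library version is restricted
  to complex-valued integrands.
\<close>
definition riesz_projection ::
    "('a::complex_banach \<Rightarrow> 'a) \<Rightarrow> complex \<Rightarrow> real \<Rightarrow> 'a \<Rightarrow> 'a" where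
  "riesz_projection T l \<epsilon> x =
     (1 / (2 * of_real pi * \<i>)) *\<^sub>C
       integral {0..1} (\<lambda>t. vector_derivative (circlepath l \<epsilon>) (at t) *\<^sub>C
                              resolvent T (circlepath l \<epsilon> t) x)"

text \<open>
  Simple means algebraic multiplicity one, where the algebraic multiplicity of an isolated eigenvalue
  is the dimension of the range of its Riesz projection. The projection does not depend on the radius,
  as long as the closed disk contains no other point of the spectrum.
\<close>
definition simple_isolated_eigenvalue :: "('a::complex_banach \<Rightarrow> 'a) \<Rightarrow> complex \<Rightarrow> bool" where
  "simple_isolated_eigenvalue T l \<longleftrightarrow>
     (\<exists>v. v \<noteq> 0 \<and> T v = l *\<^sub>C v) \<and>
     (\<exists>\<epsilon>>0. spectrum T \<inter> cball l \<epsilon> = {l} \<and> cdim (range (riesz_projection T l \<epsilon>)) = 1)"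

definition has_spectral_gap :: "('a::complex_banach \<Rightarrow> 'a) \<Rightarrow> bool" where
  "has_spectral_gap T \<longleftrightarrow>
     (\<exists>l. simple_isolated_eigenvalue T l \<and> cmod l = spectral_radius T \<and>
          (\<exists>\<rho>\<ge>0. \<rho> < spectral_radius T \<and> spectrum T - {l} \<subseteq> cball 0 \<rho>))"

end

theory Submission
  imports Defs
begin

text \<open>
  Two points of \<open>T(C\<^sup>*)\<close> lie on a holomorphic disk inside \<open>C\<close>, at pseudo-hyperbolic distance at most some
  \<open>\<sigma> < 1\<close> that depends only on the diameter \<open>\<Delta>\<close>: this is what a finite distance under the universal
  covering means. In an affine chart in which the section of \<open>C\<close> is bounded, which exists by bounded
  sectional aperture, the Schwarz lemma therefore shrinks the diameter by \<open>\<sigma>\<close> at every application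
  of \<open>T\<close>. So the lines spanned by \<open>T\<^sup>n a\<close> and \<open>T\<^sup>n b\<close> approach each other like \<open>\<sigma>\<^sup>n\<close>, which
  produces an eigenvector \<open>h\<close> with eigenvalue \<open>l\<close>, and \<open>l\<^sup>-\<^sup>n T\<^sup>n y\<close> converges to a multiple of \<open>h\<close> at rate
  \<open>\<sigma>\<^sup>n\<close> for \<open>y \<in> C\<close>. Inner regularity extends this to every vector, with limit \<open>\<nu>(x) h\<close>, and the resolvent
  is \<open>\<nu>(x)/(z - l) h + \<Sum>\<^sub>n z\<^sup>-\<^sup>n\<^sup>-\<^sup>1 T\<^sup>n(x - \<nu>(x) h)\<close> for \<open>|z| > \<sigma> |l|\<close>.
\<close>

section \<open>Length of paths in the disk\<close>

text \<open>The hypothesis on \<open>deriv F\<close> says that \<open>F\<close> is 1-Lipschitz from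
  the hyperbolic metric of the disk to the Euclidean metric of the plane. The derivative of
  \<open>F \<circ> \<gamma>\<close> is then dominated by the integrand of
  \<open>disk_length\<close>, and integration gives the claim.\<close>

lemma disk_length_lower_bound:
  assumes \<gamma>: "valid_path \<gamma>" "path_image \<gamma> \<subseteq> ball 0 1"
    and len: "disk_length \<gamma> \<le> ennreal L" "0 \<le> L"
    and F: "F holomorphic_on ball 0 1"
    and F': "\<And>z. z \<in> ball 0 1 \<Longrightarrow> cmod (deriv F z) \<le> 2 / (1 - (cmod z)\<^sup>2)"
  shows "cmod (F (pathfinish \<gamma>) - F (pathstart \<gamma>)) \<le> L"
proof -
  have cont: "continuous_on {0..1} \<gamma>"
    using \<gamma>(1) by (simp add: valid_path_def piecewise_C1_differentiable_on_def)
  obtain S D where S: "finite S"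
    and D: "\<And>t. t \<in> {0..1} - S \<Longrightarrow> (\<gamma> has_vector_derivative D t) (at t)"
    and contD: "continuous_on ({0..1} - S) D"
    using \<gamma>(1) unfolding valid_path_def piecewise_C1_differentiable_on_def
      C1_differentiable_on_def by metis
  have in_ball: "\<gamma> t \<in> ball 0 1" if "t \<in> {0..1}" for t
    using \<gamma>(2) that unfolding path_image_def by blast
  \<comment> \<open>Removing the endpoints and the finitely many exceptional points leaves an open
    set on which the integrand of \<open>disk_length\<close> is continuous. Cut off to it, the
    integrand becomes the Borel function \<open>g\<close>, whose integral is at most the
    length.\<close>
  define A where "A = {0<..<1} - S"
  have A: "open A" "A \<subseteq> {0..1} - S"
    using S by (auto simp: A_def open_Diff finite_imp_closed)
  define g where "g t = indicator A t * (2 * cmod (D t) / (1 - (cmod (\<gamma> t))\<^sup>2))" for t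
  have sq: "(cmod z)\<^sup>2 < 1" if "z \<in> ball 0 1" for z
    using that by (simp add: power_less_one_iff)
  have "continuous_on A (\<lambda>t. 2 * cmod (D t) / (1 - (cmod (\<gamma> t))\<^sup>2))"
  proof (intro continuous_intros)
    show "continuous_on A D" "continuous_on A \<gamma>"
      using A by (auto intro: continuous_on_subset contD continuous_on_subset[OF cont])
    show "\<forall>t\<in>A. 1 - (cmod (\<gamma> t))\<^sup>2 \<noteq> 0"
    proof
      fix t assume "t \<in> A"
      then show "1 - (cmod (\<gamma> t))\<^sup>2 \<noteq> 0"
        using A(2) sq[OF in_ball, of t] by auto
    qed
  qed
  then have "g \<in> borel_measurable borel"
    using borel_measurable_continuous_on_indicator[of A "\<lambda>t. 2 * cmod (D t) / (1 - (cmod (\<gamma> t))\<^sup>2)"] A(1)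
    unfolding g_def by simp
  moreover have g0: "0 \<le> g t" for t
    using sq[OF in_ball, of t] A by (cases "t \<in> A") (auto simp: g_def)
  moreover have "(\<integral>\<^sup>+t. g t \<partial>lborel) \<le> ennreal L"
  proof -
    have "(\<integral>\<^sup>+t. g t \<partial>lborel) \<le> disk_length \<gamma>"
      unfolding disk_length_def
    proof (rule nn_integral_mono)
      fix t
      show "ennreal (g t) \<le> ennreal (2 * cmod (vector_derivative \<gamma> (at t)) / (1 - (cmod (\<gamma> t))\<^sup>2)) * indicator {0..1} t"
        using A vector_derivative_at[OF D, of t] by (cases "t \<in> A") (auto simp: g_def)
    qed
    with len show ?thesis by simp
  qed
  \<comment> \<open>A finite nonnegative Lebesgue integral is also a gauge integral, the form in
    which the fundamental theorem of calculus is applied to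
    \<open>F \<circ> \<gamma>\<close>.\<close>
  moreover obtain r where r: "(\<integral>\<^sup>+t. g t \<partial>lborel) = ennreal r" "0 \<le> r"
    using calculation by (cases "\<integral>\<^sup>+t. g t \<partial>lborel" rule: ennreal_cases) (auto simp: top_unique)
  ultimately have gint: "(g has_integral r) UNIV" and rL: "r \<le> L"
    using len(2) by (auto intro!: nn_integral_has_integral)
  have "g = (\<lambda>t. if t \<in> {0..1} then g t else 0)"
    using A by (auto simp: g_def fun_eq_iff indicator_def)
  with gint have gint: "(g has_integral r) {0..1}"
    using has_integral_restrict_UNIV by metis
  define f where "f t = (if t \<in> A then deriv F (\<gamma> t) * D t else 0)" for t
  have "(f has_integral ((F \<circ> \<gamma>) 1 - (F \<circ> \<gamma>) 0)) {0..1}"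
  proof (rule fundamental_theorem_of_calculus_interior_strong[OF S])
    show "continuous_on {0..1} (F \<circ> \<gamma>)"
      using in_ball by (intro continuous_on_compose cont holomorphic_on_imp_continuous_on
          holomorphic_on_subset[OF F]) auto
    fix t :: real assume t: "t \<in> {0<..<1} - S"
    have "(F has_field_derivative deriv F (\<gamma> t)) (at (\<gamma> t))"
      using t in_ball[of t] by (intro holomorphic_derivI[OF F]) auto
    from field_vector_diff_chain_at[OF D this]
    show "(F \<circ> \<gamma> has_vector_derivative f t) (at t)"
      using t by (simp add: f_def A_def mult.commute)
  qed simp
  moreover have "cmod (f t) \<le> g t" if "t \<in> {0..1}" for t
    using F'[OF in_ball[OF that]] mult_right_mono[OF F'[OF in_ball[OF that]], of "cmod (D t)"]
    by (auto simp: f_def g_def norm_mult)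
  ultimately have "cmod (integral {0..1} f) \<le> integral {0..1} g"
    using gint by (intro integral_norm_bound_integral) auto
  moreover have "integral {0..1} f = F (pathfinish \<gamma>) - F (pathstart \<gamma>)"
    using \<open>(f has_integral _) {0..1}\<close> by (simp add: integral_unique pathfinish_def pathstart_def)
  ultimately show ?thesis
    using gint rL by (simp add: integral_unique)
qed

text \<open>This identity is the infinitesimal form of the invariance of the hyperbolic metric under
  disk automorphisms. It rests on
  \<open>|1 - cnj w z|^2 - |z - w|^2 = (1 - |w|^2) (1 - |z|^2)\<close>; the parameter
  \<open>t\<close> is only a rotation and drops out of the norm.\<close>

lemma Moebius_function_norm_square:
  assumes "norm w < 1" "norm z < 1"
  shows "1 - cnj w * z \<noteq> 0"
    and "1 - (norm (Moebius_function t w z))\<^sup>2 =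
      (1 - (norm w)\<^sup>2) * (1 - (norm z)\<^sup>2) / (norm (1 - cnj w * z))\<^sup>2"
proof -
  have "norm (cnj w * z) < 1"
    using assms by (simp add: norm_mult) (metis mult_strict_mono' norm_ge_zero mult_1)
  then show nz: "1 - cnj w * z \<noteq> 0"
    by (metis norm_one less_irrefl right_minus_eq)
  have "(norm (1 - cnj w * z))\<^sup>2 - (norm (z - w))\<^sup>2 = (1 - (norm w)\<^sup>2) * (1 - (norm z)\<^sup>2)"
    unfolding cmod_power2 by (simp add: algebra_simps power2_eq_square)
  then show "1 - (norm (Moebius_function t w z))\<^sup>2 =
      (1 - (norm w)\<^sup>2) * (1 - (norm z)\<^sup>2) / (norm (1 - cnj w * z))\<^sup>2"
    using nz by (simp add: Moebius_function_def norm_mult norm_divide power_divide divide_simps)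
qed

text \<open>Compare with the branch of \<open>log ((1 + \<phi>) / (1 - \<phi>))\<close>, where \<open>\<phi>\<close> moves the initial point to \<open>0\<close>
  and the final point to the positive real axis.\<close>
lemma disk_length_ge_Moebius:
  assumes \<gamma>: "valid_path \<gamma>" "path_image \<gamma> \<subseteq> ball 0 1"
    and len: "disk_length \<gamma> \<le> ennreal L" "0 \<le> L"
  shows "cmod (Moebius_function 0 (pathstart \<gamma>) (pathfinish \<gamma>)) \<le> (exp L - 1) / (exp L + 1)"
proof -
  let ?a = "pathstart \<gamma>" and ?b = "pathfinish \<gamma>"
  have ab: "norm ?a < 1" "norm ?b < 1"
    using \<gamma>(2) pathstart_in_path_image[of \<gamma>] pathfinish_in_path_image[of \<gamma>] by auto
  define p where "p = cmod (Moebius_function 0 ?a ?b)"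
  \<comment> \<open>The unimodular factor that turns the image of the endpoint onto the real number
    \<open>p\<close>; for \<open>p = 0\<close> every phase does, and 1 is taken.\<close>
  define u where "u = (if p = 0 then 1 else cnj (Moebius_function 0 ?a ?b) / p)"
  have u: "norm u = 1"
    by (auto simp: u_def p_def norm_divide)
  define \<phi> where "\<phi> z = u * Moebius_function 0 ?a z" for z
  have \<phi>b: "\<phi> ?b = of_real p"
    by (auto simp: \<phi>_def u_def p_def complex_norm_square power2_eq_square field_simps)
      (metis complex_norm_square mult.commute power2_eq_square of_real_mult)
  have \<phi>a: "\<phi> ?a = 0"
    by (simp add: \<phi>_def Moebius_function_eq_zero)
  have norm\<phi>: "norm (\<phi> z) < 1" if "z \<in> ball 0 1" for z
    using Moebius_function_norm_lt_1[of ?a z 0] that ab u by (simp add: \<phi>_def norm_mult)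
  have hol\<phi>: "\<phi> holomorphic_on ball 0 1"
    unfolding \<phi>_def by (intro holomorphic_intros Moebius_function_holomorphic ab)
  define F where "F z = Ln ((1 + \<phi> z) / (1 - \<phi> z))" for z
  have nz: "1 - \<phi> z \<noteq> 0" "1 + \<phi> z \<noteq> 0" "(1 + \<phi> z) / (1 - \<phi> z) \<notin> \<real>\<^sub>\<le>\<^sub>0" if "z \<in> ball 0 1" for z
  proof -
    show 1: "1 - \<phi> z \<noteq> 0" using norm\<phi>[OF that] by auto
    show "1 + \<phi> z \<noteq> 0" using norm\<phi>[OF that]
      by (metis add_eq_0_iff norm_minus_cancel norm_one less_irrefl)
    show "(1 + \<phi> z) / (1 - \<phi> z) \<notin> \<real>\<^sub>\<le>\<^sub>0"
    proof
      assume "(1 + \<phi> z) / (1 - \<phi> z) \<in> \<real>\<^sub>\<le>\<^sub>0"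
      then obtain x where "(1 + \<phi> z) / (1 - \<phi> z) = of_real x" "x \<le> 0"
        by (auto elim: nonpos_Reals_cases)
      \<comment> \<open>Solving the Cayley transform for \<open>\<phi> z\<close>: since
        \<open>|1 + x| \<le> |x - 1|\<close> for \<open>x \<le> 0\<close>, a nonpositive value
        \<open>x\<close> would force \<open>|\<phi> z| \<ge> 1\<close>.\<close>
      then have "\<phi> z * of_real (1 + x) = of_real (x - 1)"
        using 1 by (simp add: field_simps)
      then have "norm (\<phi> z) * \<bar>1 + x\<bar> = \<bar>x - 1\<bar>"
        by (metis norm_mult norm_of_real)
      moreover have "norm (\<phi> z) * \<bar>1 + x\<bar> \<le> norm (\<phi> z) * \<bar>x - 1\<bar>"
        using \<open>x \<le> 0\<close> by (intro mult_left_mono) auto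
      ultimately show False
        using norm\<phi>[OF that] \<open>x \<le> 0\<close> by (auto simp: mult_le_cancel_right1)
    qed
  qed
  have holF: "F holomorphic_on ball 0 1"
    unfolding F_def by (intro holomorphic_intros hol\<phi>) (use nz in auto)
  have derF: "cmod (deriv F z) \<le> 2 / (1 - (cmod z)\<^sup>2)" if z: "z \<in> ball 0 1" for z
  proof -
    define q where "q = 1 - cnj ?a * z"
    have q: "q \<noteq> 0"
      using Moebius_function_norm_square[of ?a z] ab z by (simp add: q_def)
    define \<phi>' where "\<phi>' = u * (1 - (norm ?a)\<^sup>2) / q\<^sup>2"
    have "((\<lambda>z. u * ((z - ?a) / (1 - cnj ?a * z))) has_field_derivative
        u * ((1 * (1 - cnj ?a * z) - (z - ?a) * (0 - cnj ?a * 1)) / ((1 - cnj ?a * z) * (1 - cnj ?a * z)))) (at z)"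
      by (rule derivative_eq_intros refl | use q in \<open>simp add: q_def\<close>)+
    moreover have "u * ((1 * (1 - cnj ?a * z) - (z - ?a) * (0 - cnj ?a * 1)) / ((1 - cnj ?a * z) * (1 - cnj ?a * z))) = \<phi>'"
      by (simp add: \<phi>'_def q_def power2_eq_square complex_norm_square[unfolded power2_eq_square] algebra_simps
          flip: of_real_mult)
    ultimately have d\<phi>: "(\<phi> has_field_derivative \<phi>') (at z)"
      by (simp add: \<phi>_def[abs_def] Moebius_function_simple)
    \<comment> \<open>Equality in Schwarz-Pick: \<open>\<phi>\<close> is a hyperbolic isometry. The
      only loss in the bound on \<open>deriv F\<close> is the estimate
      \<open>1 - |\<phi> z|^2 \<le> |1 - (\<phi> z)^2|\<close> below.\<close>
    have n: "norm \<phi>' / (1 - (norm (\<phi> z))\<^sup>2) = 1 / (1 - (norm z)\<^sup>2)"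
    proof -
      have "(norm ?a)\<^sup>2 < 1" "(norm z)\<^sup>2 < 1"
        using ab z by (auto simp: power_less_one_iff)
      moreover from this have "norm (1 - (complex_of_real (norm ?a))\<^sup>2) = 1 - (norm ?a)\<^sup>2"
        by (metis abs_of_pos diff_gt_0_iff_gt norm_of_real of_real_1 of_real_diff of_real_power)
      moreover have "(norm (Moebius_function 0 ?a z))\<^sup>2 < 1"
        using Moebius_function_norm_lt_1[of ?a z 0] ab z by (simp add: power_less_one_iff)
      moreover have "(cmod q)\<^sup>2 * (1 - (norm (Moebius_function 0 ?a z))\<^sup>2) = (1 - (norm ?a)\<^sup>2) * (1 - (norm z)\<^sup>2)"
        using Moebius_function_norm_square(2)[of ?a z 0] ab z q by (simp add: q_def)
      ultimately show ?thesis
        using u q by (simp add: \<phi>'_def \<phi>_def norm_mult norm_divide norm_power q_def[symmetric] divide_simps)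
    qed
    have "(F has_field_derivative 2 * \<phi>' / (1 - (\<phi> z)\<^sup>2)) (at z)"
    proof -
      have "((\<lambda>z. Ln ((1 + \<phi> z) / (1 - \<phi> z))) has_field_derivative
         inverse ((1 + \<phi> z) / (1 - \<phi> z)) * (((0 + \<phi>') * (1 - \<phi> z) - (1 + \<phi> z) * (0 - \<phi>')) / ((1 - \<phi> z) * (1 - \<phi> z)))) (at z)"
        by (rule derivative_eq_intros d\<phi> refl nz z)+
      moreover have "inverse ((1 + \<phi> z) / (1 - \<phi> z)) * (((0 + \<phi>') * (1 - \<phi> z) - (1 + \<phi> z) * (0 - \<phi>')) / ((1 - \<phi> z) * (1 - \<phi> z)))
        = 2 * \<phi>' / ((1 + \<phi> z) * (1 - \<phi> z))"
        using nz(1,2)[OF z] by (simp add: divide_simps) algebra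
      moreover have "(1 + \<phi> z) * (1 - \<phi> z) = 1 - (\<phi> z)\<^sup>2"
        by algebra
      ultimately show ?thesis
        by (simp add: F_def[abs_def])
    qed
    then have "cmod (deriv F z) = 2 * norm \<phi>' / norm (1 - (\<phi> z)\<^sup>2)"
      by (simp add: DERIV_imp_deriv norm_mult norm_divide)
    also have "\<dots> \<le> 2 * norm \<phi>' / (1 - (norm (\<phi> z))\<^sup>2)"
    proof (rule divide_left_mono)
      show le: "1 - (norm (\<phi> z))\<^sup>2 \<le> norm (1 - (\<phi> z)\<^sup>2)"
        using norm_triangle_ineq2[of 1 "(\<phi> z)\<^sup>2"] by (simp add: norm_power)
      have "0 < 1 - (norm (\<phi> z))\<^sup>2"
        using norm\<phi>[OF z] by (simp add: power_less_one_iff)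
      then show "0 < norm (1 - (\<phi> z)\<^sup>2) * (1 - (norm (\<phi> z))\<^sup>2)"
        using le by (intro mult_pos_pos) auto
    qed simp
    also have "\<dots> = 2 / (1 - (cmod z)\<^sup>2)"
      using n by simp
    finally show ?thesis .
  qed
  have p: "0 \<le> p" "p < 1"
    using norm\<phi>[of ?b] ab \<phi>b by (auto simp: p_def)
  have "cmod (F ?b - F ?a) \<le> L"
    by (rule disk_length_lower_bound[OF \<gamma> len holF derF])
  moreover have "F ?a = 0"
    by (simp add: F_def \<phi>a)
  moreover have "F ?b = of_real (ln ((1 + p) / (1 - p)))"
  proof -
    have "0 < (1 + p) / (1 - p)" using p by simp
    from Ln_of_real[OF this] show ?thesis by (simp add: F_def \<phi>b)
  qed
  moreover have "0 \<le> ln ((1 + p) / (1 - p))"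
    using p by simp
  ultimately have "ln ((1 + p) / (1 - p)) \<le> L"
    by simp
  \<comment> \<open>Solved for \<open>p\<close>, this is \<open>p \<le> tanh (L / 2)\<close>, since
    \<open>(exp L - 1) / (exp L + 1) = tanh (L / 2)\<close>. This number is the contraction factor
    in everything that follows.\<close>
  then have "(1 + p) / (1 - p) \<le> exp L"
    using p by (metis add_pos_nonneg diff_gt_0_iff_gt divide_pos_pos exp_le_cancel_iff exp_ln zero_less_one)
  then show ?thesis
    using p by (simp add: p_def[symmetric] field_simps add_pos_pos)
qed

section \<open>The Schwarz lemma at an arbitrary zero\<close>

text \<open>An automorphism of the disk moves the zero \<open>a\<close> to the origin, where the
  Schwarz lemma applies to \<open>f\<close> divided by its bound.\<close>

lemma holomorphic_disk_bound:
  fixes f :: "complex \<Rightarrow> complex"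
  assumes f: "f holomorphic_on ball 0 1" "f a = 0" and "a \<in> ball 0 1" "b \<in> ball 0 1"
    and bd: "\<And>z. z \<in> ball 0 1 \<Longrightarrow> cmod (f z) \<le> M"
  shows "cmod (f b) \<le> M * cmod (Moebius_function 0 a b)"
proof -
  have M: "0 \<le> M" using bd[OF assms(3)] f(2) by simp
  define w where "w = Moebius_function 0 a b"
  have w: "norm w < 1"
    using assms by (simp add: w_def Moebius_function_norm_lt_1)
  have b: "Moebius_function 0 (-a) w = b"
    using assms unfolding w_def by (intro Moebius_function_compose) auto
  \<comment> \<open>The Schwarz lemma needs values strictly inside the disk and a nonzero divisor,
    whereas \<open>M\<close> is a weak bound and may be 0. So a larger \<open>M'\<close> is used
    first and then sent to \<open>M\<close>.\<close>
  have "cmod (f b) \<le> M' * cmod w" if M': "M' > M" for M'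
  proof -
    let ?g = "\<lambda>z. f (Moebius_function 0 (-a) z) / M'"
    have "norm (?g w) \<le> norm w"
    proof (rule Schwarz_Lemma)
      have "(f \<circ> Moebius_function 0 (-a)) holomorphic_on ball 0 1"
        using assms by (intro holomorphic_on_compose_gen[OF Moebius_function_holomorphic f(1)])
          (auto simp: Moebius_function_norm_lt_1)
      then show "?g holomorphic_on ball 0 1"
        using M' M by (intro holomorphic_intros) (auto simp: o_def)
      show "?g 0 = 0"
        using f(2) by (simp add: Moebius_function_of_zero)
      show "norm (?g z) < 1" if "norm z < 1" for z
      proof -
        have "norm (f (Moebius_function 0 (-a) z)) \<le> M"
          using assms that by (intro bd) (simp add: Moebius_function_norm_lt_1)
        with M' M show ?thesis by (simp add: norm_divide)
      qed
    qed (rule w)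
    then show ?thesis
      using M M' b by (simp add: norm_divide field_simps)
  qed
  then have "\<forall>\<^sub>F M' in at_right M. cmod (f b) \<le> M' * cmod w"
    by (simp add: eventually_at_right_less eventually_mono[OF eventually_at_right_less])
  moreover have "((\<lambda>M'. M' * cmod w) \<longlongrightarrow> M * cmod w) (at_right M)"
    by (intro tendsto_intros)
  ultimately show ?thesis
    unfolding w_def[symmetric] by (intro tendsto_lowerbound) auto
qed

section \<open>Complex linear algebra\<close>

text \<open>Makes the general rules for limits, continuity, sums and integrals under bounded
  bilinear maps available for complex scaling.\<close>

lemma bounded_bilinear_scaleC:
  "bounded_bilinear (scaleC :: complex \<Rightarrow> 'a::complex_normed_vector \<Rightarrow> 'a)"
proof
  fix a a' r and b b' :: 'a
  show "(a + a') *\<^sub>C b = a *\<^sub>C b + a' *\<^sub>C b" by (rule scaleC_add_left)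
  show "a *\<^sub>C (b + b') = a *\<^sub>C b + a *\<^sub>C b'" by (rule scaleC_add_right)
  show "(r *\<^sub>R a) *\<^sub>C b = r *\<^sub>R a *\<^sub>C b"
    using scaleC_of_real[of r "a *\<^sub>C b"] by (simp add: scaleC_scaleC scaleR_conv_of_real)
  show "a *\<^sub>C (r *\<^sub>R b) = r *\<^sub>R a *\<^sub>C b"
    by (simp flip: scaleC_of_real add: scaleC_scaleC mult.commute)
  show "\<exists>K. \<forall>a (b::'a). norm (a *\<^sub>C b) \<le> norm a * norm b * K"
    by (rule exI[of _ 1]) (simp add: norm_scaleC)
qed

interpretation scaleC: bounded_bilinear "scaleC :: complex \<Rightarrow> 'a::complex_normed_vector \<Rightarrow> 'a"
  by (rule bounded_bilinear_scaleC)

lemma scaleC_one: "1 *\<^sub>C x = (x :: 'a::complex_normed_vector)"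
  by (rule complex_vector.scale_one)

text \<open>Reduces complex bounded linearity to real bounded linearity plus homogeneity, so that
  facts about \<open>bounded_linear\<close> apply to \<open>T\<close>.\<close>

lemma bounded_clinear_iff:
  fixes T :: "'a::complex_normed_vector \<Rightarrow> 'b::complex_normed_vector"
  shows "bounded_clinear T \<longleftrightarrow> bounded_linear T \<and> (\<forall>c x. T (c *\<^sub>C x) = c *\<^sub>C T x)"
proof
  assume T: "bounded_clinear T"
  then have lin: "T (x + y) = T x + T y" "T (c *\<^sub>C x) = c *\<^sub>C T x" for x y c
    by (auto simp: bounded_clinear_def Vector_Spaces.linear_iff)
  obtain B where "\<forall>x. norm (T x) \<le> norm x * B"
    using T by (auto simp: bounded_clinear_def)
  then have "bounded_linear T"
    using lin(1) lin(2)[of "complex_of_real _"]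
    by (intro bounded_linear_intro[of T B]) (auto simp: scaleC_of_real)
  with lin show "bounded_linear T \<and> (\<forall>c x. T (c *\<^sub>C x) = c *\<^sub>C T x)" by blast
next
  assume T: "bounded_linear T \<and> (\<forall>c x. T (c *\<^sub>C x) = c *\<^sub>C T x)"
  then have "\<And>x y. T (x + y) = T x + T y"
    by (simp add: bounded_linear.linear linear_add)
  with T show "bounded_clinear T"
    unfolding bounded_clinear_def Vector_Spaces.linear_iff
    by (intro conjI complex_vector.vector_space_axioms) (auto intro: bounded_linear.bounded)
qed

lemma bounded_clinear_funpow:
  fixes T :: "'a::complex_normed_vector \<Rightarrow> 'a"
  assumes "bounded_clinear T"
  shows "bounded_clinear (T ^^ n)"
proof (induction n)
  case 0
  show ?case by (simp add: bounded_clinear_iff id_def)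
next
  case (Suc n)
  with assms show ?case
    by (auto simp: bounded_clinear_iff o_def intro: bounded_linear_compose)
qed

lemma bounded_clinear_subspace_image:
  assumes T: "bounded_clinear T" and W: "complex_vector.subspace W"
  shows "complex_vector.subspace (T ` W)"
  unfolding complex_vector.subspace_def
proof (intro conjI ballI allI)
  have Tlin: "T (c *\<^sub>C x) = c *\<^sub>C T x" "T (x + y) = T x + T y" for c x y
    using T by (auto simp: bounded_clinear_iff bounded_linear.linear linear_add)
  show "0 \<in> T ` W"
    using complex_vector.subspace_0[OF W] Tlin(1)[of 0 0] by force
  show "x + y \<in> T ` W" if "x \<in> T ` W" "y \<in> T ` W" for x y
    using that complex_vector.subspace_add[OF W] Tlin(2) by (metis (no_types, lifting) imageE imageI)
  show "c *\<^sub>C x \<in> T ` W" if "x \<in> T ` W" for c x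
    using that complex_vector.subspace_scale[OF W] Tlin(1) by (metis (no_types, lifting) imageE imageI)
qed

section \<open>Complex spans of two vectors and functionals on them\<close>

lemma cspan_pair_iff: "z \<in> cspan {x, y} \<longleftrightarrow> (\<exists>a b. z = a *\<^sub>C x + b *\<^sub>C y)"
  by (simp add: complex_vector.span_breakdown_eq complex_vector.span_singleton image_iff)
     (metis add_diff_cancel_left' diff_add_cancel add.commute)

lemma cdependent_pair_iff:
  assumes "x \<noteq> y"
  shows "cdependent {x, y} \<longleftrightarrow> (\<exists>a b. (a \<noteq> 0 \<or> b \<noteq> 0) \<and> a *\<^sub>C x + b *\<^sub>C y = 0)"
proof
  assume "cdependent {x, y}"
  then obtain u where "(\<exists>v\<in>{x, y}. u v \<noteq> 0) \<and> (\<Sum>v\<in>{x, y}. u v *\<^sub>C v) = 0"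
    using complex_vector.dependent_finite[of "{x, y}"] by auto
  with assms show "\<exists>a b. (a \<noteq> 0 \<or> b \<noteq> 0) \<and> a *\<^sub>C x + b *\<^sub>C y = 0"
    by auto
next
  assume "\<exists>a b. (a \<noteq> 0 \<or> b \<noteq> 0) \<and> a *\<^sub>C x + b *\<^sub>C y = 0"
  then obtain a b where ab: "a \<noteq> 0 \<or> b \<noteq> 0" "a *\<^sub>C x + b *\<^sub>C y = 0" by blast
  define u where "u v = (if v = x then a else b)" for v
  have "(\<exists>v\<in>{x, y}. u v \<noteq> 0) \<and> (\<Sum>v\<in>{x, y}. u v *\<^sub>C v) = 0"
    using ab assms by (auto simp: u_def)
  then show "cdependent {x, y}"
    using complex_vector.dependent_finite[of "{x, y}"] by (metis finite.emptyI finite.insertI)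
qed

text \<open>\<open>functional_norm\<close> is a real supremum and means something only if the
  quotients are bounded. On a line the bound is explicit; on a plane, compactness of the unit sphere
  of the coefficient space bounds \<open>a\<close> and \<open>b\<close> by the norm of
  \<open>a *\<^sub>C x + b *\<^sub>C y\<close>.\<close>

lemma functional_on_cspan_pair_bounded:
  fixes x y :: "'a::complex_normed_vector"
  assumes m: "functional_on (cspan {x, y}) m"
  shows "\<exists>B\<ge>0. \<forall>u\<in>cspan {x, y}. cmod (m u) \<le> B * norm u"
proof -
  have xy: "x \<in> cspan {x, y}" "y \<in> cspan {x, y}"
    by (auto intro: complex_vector.span_base)
  have msc: "m (a *\<^sub>C u) = a * m u" if "u \<in> cspan {x, y}" for a u
    using m that by (auto simp: functional_on_def)
  have mlin: "m (a *\<^sub>C x + b *\<^sub>C y) = a * m x + b * m y" for a b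
    using m xy msc complex_vector.span_scale[OF xy(1), of a] complex_vector.span_scale[OF xy(2), of b]
    by (simp add: functional_on_def)
  \<comment> \<open>The case of a span generated by one vector \<open>w\<close>. For
    \<open>w = 0\<close> the proposed constant is a division by zero, hence 0, which is right
    because \<open>m\<close> vanishes at 0.\<close>
  have line: ?thesis if w: "w \<in> cspan {x, y}" and sp: "\<And>a b. \<exists>c. a *\<^sub>C x + b *\<^sub>C y = c *\<^sub>C w" for w
  proof (intro exI conjI ballI)
    show "0 \<le> cmod (m w) / norm w" by simp
    fix u assume "u \<in> cspan {x, y}"
    then obtain c where u: "u = c *\<^sub>C w" using sp by (auto simp: cspan_pair_iff)
    show "cmod (m u) \<le> cmod (m w) / norm w * norm u"
      using msc[OF w, of c] msc[OF w, of 0]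
      by (cases "w = 0") (auto simp: u norm_scaleC norm_mult)
  qed
  show ?thesis
  proof (cases "\<exists>a b. (a \<noteq> 0 \<or> b \<noteq> 0) \<and> a *\<^sub>C x + b *\<^sub>C y = 0")
    case True
    then obtain a b where ab: "a \<noteq> 0 \<or> b \<noteq> 0" "a *\<^sub>C x + b *\<^sub>C y = 0" by blast
    show ?thesis
    \<comment> \<open>For \<open>a \<noteq> 0\<close> the vector \<open>y\<close> generates the
      span; for \<open>a = 0\<close> the relation gives \<open>y = 0\<close>, and \<open>x\<close>
      does.\<close>
    proof (cases "a = 0")
      case False
      have "x = inverse a *\<^sub>C (a *\<^sub>C x)" using False by (simp add: scaleC_scaleC scaleC_one)
      also have "a *\<^sub>C x = - (b *\<^sub>C y)" using ab(2) by (simp add: add_eq_0_iff)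
      finally have "x = (- inverse a * b) *\<^sub>C y" by (simp add: scaleC_scaleC)
      then show ?thesis
        using line[OF xy(2)] by (metis scaleC_add_left scaleC_scaleC)
    next
      case True
      with ab have "b \<noteq> 0" by auto
      have "y = inverse b *\<^sub>C (b *\<^sub>C y)" using \<open>b \<noteq> 0\<close> by (simp add: scaleC_scaleC scaleC_one)
      then have "y = 0 *\<^sub>C x" using True ab by simp
      then show ?thesis
        using line[OF xy(1)] by (metis scaleC_add_left scaleC_scaleC)
    qed
  next
    case False
    define S where "S = sphere (0 :: complex \<times> complex) 1"
    have "\<exists>p\<in>S. \<forall>p'\<in>S. norm (fst p *\<^sub>C x + snd p *\<^sub>C y) \<le> norm (fst p' *\<^sub>C x + snd p' *\<^sub>C y)"
    proof (rule continuous_attains_inf)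
      have "(1, 0) \<in> S" by (simp add: S_def)
      then show "S \<noteq> {}" by blast
    qed (auto simp: S_def intro!: continuous_intros scaleC.continuous_on)
    then obtain p where p: "p \<in> S"
      and min: "\<And>p'. p' \<in> S \<Longrightarrow> norm (fst p *\<^sub>C x + snd p *\<^sub>C y) \<le> norm (fst p' *\<^sub>C x + snd p' *\<^sub>C y)"
      by blast
    define \<delta> where "\<delta> = norm (fst p *\<^sub>C x + snd p *\<^sub>C y)"
    have "p \<noteq> 0" using p by (auto simp: S_def)
    then have "\<delta> > 0" using False by (auto simp: \<delta>_def prod_eq_iff)
    have low: "\<delta> * norm (a, b) \<le> norm (a *\<^sub>C x + b *\<^sub>C y)" for a b
    proof (cases "(a, b) = 0")
      case False
      define s where "s = norm (a, b)"
      have s: "s > 0" using False by (simp add: s_def)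
      have "inverse s *\<^sub>R (a, b) \<in> S"
        using False by (simp add: S_def s_def del: scaleR_Pair)
      from min[OF this] have "\<delta> \<le> norm (inverse s *\<^sub>R (a *\<^sub>C x + b *\<^sub>C y))"
        by (simp add: \<delta>_def scaleR_add_right scaleC.scaleR_left)
      also have "\<dots> = norm (a *\<^sub>C x + b *\<^sub>C y) / s"
        using s by (simp only: norm_scaleR) (simp add: divide_inverse mult.commute)
      finally show ?thesis
        using s by (simp add: s_def[symmetric] pos_le_divide_eq)
    qed auto
    define B where "B = (cmod (m x) + cmod (m y)) / \<delta>"
    have "cmod (m u) \<le> B * norm u" if u': "u \<in> cspan {x, y}" for u
    proof -
      obtain a b where u: "u = a *\<^sub>C x + b *\<^sub>C y" using u' by (auto simp: cspan_pair_iff)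
      have "cmod (m u) \<le> cmod a * cmod (m x) + cmod b * cmod (m y)"
        unfolding u mlin by (rule order.trans[OF norm_triangle_ineq]) (simp add: norm_mult)
      also have "\<dots> \<le> norm (a, b) * cmod (m x) + norm (a, b) * cmod (m y)"
        using norm_fst_le[of a b] norm_snd_le[of b a]
        by (intro add_mono mult_right_mono) auto
      also have "\<dots> = B * (\<delta> * norm (a, b))"
        using \<open>\<delta> > 0\<close> by (simp add: B_def field_simps)
      also have "\<dots> \<le> B * norm u"
        unfolding u using \<open>\<delta> > 0\<close> by (intro mult_left_mono low) (simp add: B_def)
      finally show ?thesis .
    qed
    moreover have "B \<ge> 0" using \<open>\<delta> > 0\<close> by (simp add: B_def)
    ultimately show ?thesis by blast
  qed
qed

section \<open>Contraction of cone sections\<close>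

text \<open>A finite distance is an infimum of lengths of lifted paths, so some covering
  \<open>\<pi>\<close> of the component \<open>U\<close> carries a lift shorter than
  \<open>L\<close>, and its endpoints are the points \<open>z\<close> and \<open>w\<close>. The
  covering itself is the disk sought: \<open>a - b \<notin> C\<close> keeps \<open>\<pi>\<close>
  away from infinity, so in the chart \<open>chart_0\<close> it is an ordinary holomorphic
  function.\<close>

lemma cone_dist_obtain_disk:
  fixes a b :: "'a::complex_normed_vector"
  assumes dist: "cone_dist C a b < ennreal L" "0 \<le> L"
    and ind: "independent_pair a b" and notin: "a - b \<notin> C"
  obtains f z w where "f holomorphic_on ball 0 1" "z \<in> ball 0 1" "w \<in> ball 0 1" "f z = - 1" "f w = 1"
    "cmod (Moebius_function 0 z w) \<le> (exp L - 1) / (exp L + 1)"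
    "\<And>v. v \<in> ball 0 1 \<Longrightarrow> (1 + f v) *\<^sub>C a + (1 - f v) *\<^sub>C b \<in> C"
proof -
  define U where "U = connected_component_set (interior (gauge_set C a b)) (Fin (-1))"
  have U: "U \<subseteq> gauge_set C a b"
    unfolding U_def using connected_component_subset interior_subset by blast
  have "hyperbolic_dist U (Fin (-1)) (Fin 1) < ennreal L"
    using dist ind by (auto simp: cone_dist_def U_def[symmetric] Let_def split: if_splits)
  then obtain \<pi> \<gamma> where \<pi>: "holomorphic_disk_covering \<pi> U" and \<gamma>: "valid_path \<gamma>" "path_image \<gamma> \<subseteq> ball 0 1"
    and ends: "\<pi> (pathstart \<gamma>) = Fin (-1)" "\<pi> (pathfinish \<gamma>) = Fin 1" and len: "disk_length \<gamma> < ennreal L"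
    unfolding hyperbolic_dist_def Inf_less_iff by blast
  have im: "\<pi> ` ball 0 1 = U"
    using \<pi> by (simp add: holomorphic_disk_covering_def covering_space_imp_surjective)
  have fin: "\<pi> v \<noteq> Infty \<and> (1 + chart_0 (\<pi> v)) *\<^sub>C a + (1 - chart_0 (\<pi> v)) *\<^sub>C b \<in> C" if "v \<in> ball 0 1" for v
  proof -
    have "\<pi> v \<in> gauge_set C a b" using U im that by blast
    then show ?thesis
      using notin by (cases "\<pi> v") (auto simp: gauge_set_def)
  qed
  show ?thesis
  proof (rule that[of "chart_0 \<circ> \<pi>" "pathstart \<gamma>" "pathfinish \<gamma>"])
    have "{z \<in> ball 0 1. \<pi> z \<noteq> Infty} = ball 0 1" using fin by blast
    then show "(chart_0 \<circ> \<pi>) holomorphic_on ball 0 1"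
      using \<pi> by (simp add: holomorphic_disk_covering_def sphere_holomorphic_on_def)
    show "pathstart \<gamma> \<in> ball 0 1" "pathfinish \<gamma> \<in> ball 0 1"
      using \<gamma>(2) pathstart_in_path_image pathfinish_in_path_image by blast+
    show "cmod (Moebius_function 0 (pathstart \<gamma>) (pathfinish \<gamma>)) \<le> (exp L - 1) / (exp L + 1)"
      by (rule disk_length_ge_Moebius[OF \<gamma> less_imp_le[OF len] dist(2)])
  qed (use ends fin in auto)
qed

text \<open>The Schwarz lemma replaces the contraction of hyperbolic metrics: \<open>C\<close> contains a holomorphic disk
  through the normalizations of \<open>T u\<close> and \<open>T v\<close>, and every point of it is within \<open>d\<close> of the centre.\<close>
lemma cone_contraction_step:
  fixes T :: "'a::complex_normed_vector \<Rightarrow> 'a" and q :: "'a \<Rightarrow> real"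
  assumes T: "bounded_clinear T" "T ` (C - {0}) \<subseteq> C - {0}"
    and dist: "\<And>a b. a \<in> T ` (C - {0}) \<Longrightarrow> b \<in> T ` (C - {0}) \<Longrightarrow> cone_dist C a b < ennreal L" "0 \<le> L"
    and C: "\<And>c x. x \<in> C \<Longrightarrow> c *\<^sub>C x \<in> C"
    and W: "complex_vector.subspace W"
    and m: "functional_on (T ` W) m" "\<And>u. u \<in> C \<inter> T ` W - {0} \<Longrightarrow> m u \<noteq> 0"
    and q: "\<And>c x. q (c *\<^sub>C x) = cmod c * q x"
    and d: "\<And>u v. u \<in> C \<inter> T ` W - {0} \<Longrightarrow> v \<in> C \<inter> T ` W - {0} \<Longrightarrow>
              q (inverse (m u) *\<^sub>C u - inverse (m v) *\<^sub>C v) \<le> d"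
    and u: "u \<in> C \<inter> W - {0}" and v: "v \<in> C \<inter> W - {0}"
  shows "q (inverse (m (T u)) *\<^sub>C T u - inverse (m (T v)) *\<^sub>C T v) \<le> (exp L - 1) / (exp L + 1) * d"
proof -
  \<comment> \<open>\<open>a\<close> and \<open>b\<close> represent the lines of \<open>T u\<close>
    and \<open>T v\<close> in the affine chart where \<open>m\<close> equals 1.\<close>
  define a where "a = inverse (m (T u)) *\<^sub>C T u"
  define b where "b = inverse (m (T v)) *\<^sub>C T v"
  have Tlin: "T (c *\<^sub>C x) = c *\<^sub>C T x" "T (x + y) = T x + T y" for c x y
    using T(1) by (auto simp: bounded_clinear_iff bounded_linear.linear linear_add)
  have msc: "m (c *\<^sub>C x) = c * m x" if "x \<in> T ` W" for c x
    using m(1) that by (auto simp: functional_on_def)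
  have madd: "m (x + y) = m x + m y" if "x \<in> T ` W" "y \<in> T ` W" for x y
    using m(1) that by (auto simp: functional_on_def)
  note sub = bounded_clinear_subspace_image[OF T(1) W]
  have Tuv: "T u \<in> C \<inter> T ` W - {0}" "T v \<in> C \<inter> T ` W - {0}"
    using T(2) u v by auto
  note muv = m(2)[OF Tuv(1)] m(2)[OF Tuv(2)]
  have ab: "a \<in> C \<inter> T ` W" "b \<in> C \<inter> T ` W" and mab: "m a = 1" "m b = 1"
    using Tuv C complex_vector.subspace_scale[OF sub] muv by (simp_all add: a_def b_def msc)
  \<comment> \<open>The distance bound concerns images under \<open>T\<close>; the normalizing
    scalars are pulled inside \<open>T\<close> to stay within its scope.\<close>
  have ab_im: "a \<in> T ` (C - {0})" "b \<in> T ` (C - {0})"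
  proof -
    have "a = T (inverse (m (T u)) *\<^sub>C u)" "b = T (inverse (m (T v)) *\<^sub>C v)"
      by (simp_all add: a_def b_def Tlin)
    moreover have "inverse (m (T u)) *\<^sub>C u \<in> C - {0}" "inverse (m (T v)) *\<^sub>C v \<in> C - {0}"
      using C u v muv by auto
    ultimately show "a \<in> T ` (C - {0})" "b \<in> T ` (C - {0})" by blast+
  qed
  have q0: "q 0 = 0" using q[of 0 0] by simp
  have d0: "0 \<le> d" using d[OF Tuv(1) Tuv(1)] q0 by simp
  have sg: "0 \<le> (exp L - 1) / (exp L + 1)"
    using dist(2) by (simp add: add_pos_pos less_imp_le)
  show ?thesis
  \<comment> \<open>\<open>q\<close> is only assumed homogeneous. In the application it is
    \<open>norm ((T ^^ n) x)\<close>, which can vanish for \<open>x \<noteq> 0\<close>, and the main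
    case divides by \<open>q (a - b)\<close>.\<close>
  proof (cases "q (a - b) \<le> 0 \<or> a = b")
    case True
    then have "q (a - b) \<le> 0" using q0 by auto
    also have "0 \<le> (exp L - 1) / (exp L + 1) * d" using sg d0 by (rule mult_nonneg_nonneg)
    finally show ?thesis by (simp only: a_def b_def)
  next
    case False
    have mdiff: "m (a - b) = 0"
      using madd[of "a - b" b] ab mab complex_vector.subspace_diff[OF sub] by auto
    have "independent_pair a b"
      unfolding independent_pair_def
    proof (intro conjI notI)
      assume "cdependent {a, b}"
      then obtain s t where st: "s \<noteq> 0 \<or> t \<noteq> 0" "s *\<^sub>C a + t *\<^sub>C b = 0"
        using False by (auto simp: cdependent_pair_iff)
      \<comment> \<open>Two distinct points of the affine line where \<open>m\<close> equals 1 are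
        independent: applying \<open>m\<close> to a relation gives \<open>t = - s\<close>, which
        contradicts \<open>a \<noteq> b\<close>.\<close>
      have "m (s *\<^sub>C a + t *\<^sub>C b) = s + t"
        using ab mab msc madd complex_vector.subspace_scale[OF sub] by simp
      moreover have "m 0 = 0" using msc[of a 0] ab by simp
      ultimately have "t = - s" using st(2) by (simp add: add_eq_0_iff)
      then have "s *\<^sub>C (a - b) = 0" using st(2) by (simp add: complex_vector.scale_right_diff_distrib)
      then show False using st(1) False \<open>t = - s\<close> by auto
    qed (use False in blast)
    moreover have "a - b \<notin> C"
      using m(2)[of "a - b"] mdiff False ab complex_vector.subspace_diff[OF sub] by auto
    ultimately obtain f z w where f: "f holomorphic_on ball 0 1" and zw: "z \<in> ball 0 1" "w \<in> ball 0 1" "f z = - 1" "f w = 1"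
      "cmod (Moebius_function 0 z w) \<le> (exp L - 1) / (exp L + 1)"
      and fC: "\<And>v. v \<in> ball 0 1 \<Longrightarrow> (1 + f v) *\<^sub>C a + (1 - f v) *\<^sub>C b \<in> C"
      using cone_dist_obtain_disk[OF dist(1)[OF ab_im] dist(2)] by blast
    \<comment> \<open>On the affine line through \<open>b\<close> and \<open>a\<close> the disk has
      the coordinate \<open>(1 + f) / 2\<close>, which is 0 at \<open>b\<close> and 1 at
      \<open>a\<close>. Being within \<open>d\<close> of \<open>b\<close> bounds it by
      \<open>M\<close>, so the Schwarz lemma gives \<open>1 \<le> M * tanh (L / 2)\<close>, that is,
      \<open>q (a - b) \<le> tanh (L / 2) * d\<close>.\<close>
    define M where "M = d / q (a - b)"
    have "cmod ((1 + f w) / 2) \<le> M * cmod (Moebius_function 0 z w)"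
    proof (rule holomorphic_disk_bound[where f = "\<lambda>x. (1 + f x) / 2"])
      fix x :: complex assume x: "x \<in> ball 0 1"
      define p where "p = ((1 + f x) / 2) *\<^sub>C a + ((1 - f x) / 2) *\<^sub>C b"
      have "p = (1/2) *\<^sub>C ((1 + f x) *\<^sub>C a + (1 - f x) *\<^sub>C b)"
        by (simp add: p_def scaleC_add_right scaleC_scaleC)
      then have "p \<in> C" using C[OF fC[OF x]] by simp
      moreover have p: "p \<in> T ` W"
        unfolding p_def using ab by (intro complex_vector.subspace_add[OF sub] complex_vector.subspace_scale[OF sub]) auto
      moreover have mp: "m p = 1"
        using ab mab msc madd complex_vector.subspace_scale[OF sub] by (simp add: p_def add_divide_distrib[symmetric])
      moreover have "p \<noteq> 0" using mp msc[OF p, of 0] by auto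
      moreover have "b \<noteq> 0" using mab msc[of b 0] ab by auto
      ultimately have "q (p - b) \<le> d"
        using d[of p b] ab mab by (simp add: scaleC_one)
      moreover have "p - b = ((1 + f x) / 2) *\<^sub>C (a - b)"
      proof -
        have "((1 + f x) / 2) *\<^sub>C b + ((1 - f x) / 2) *\<^sub>C b = b"
          by (simp flip: scaleC_add_left add: add_divide_distrib[symmetric] scaleC_one)
        then show ?thesis
          by (simp add: p_def complex_vector.scale_right_diff_distrib algebra_simps)
      qed
      ultimately have "cmod ((1 + f x) / 2) * q (a - b) \<le> d"
        by (simp only: q)
      then show "cmod ((1 + f x) / 2) \<le> M"
        using False unfolding M_def by (subst pos_le_divide_eq) auto
    qed (use f zw in \<open>auto intro!: holomorphic_intros\<close>)
    also have "\<dots> \<le> M * ((exp L - 1) / (exp L + 1))"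
      using False d0 by (intro mult_left_mono zw) (simp add: M_def)
    finally have "q (a - b) * 1 \<le> q (a - b) * (M * ((exp L - 1) / (exp L + 1)))"
      using False zw(4) by (intro mult_left_mono) auto
    also have "\<dots> = (exp L - 1) / (exp L + 1) * d"
      using False by (simp add: M_def)
    finally show ?thesis by (simp only: a_def b_def mult_1_right)
  qed
qed

text \<open>The chart \<open>m\<close> is fixed on the last space \<open>(T ^^ n)\<close>
  W\<open>and pulled back along\<close>T\<open>, so a single diameter bound at time\<close>n\<open>serves all\<close>n\<open>steps. The induction applies the hypothesis to\<close>T
  \<open>W\<close> and then contracts once more, measuring by the seminorm
  \<open>norm ((T ^^ n) x)\<close> with the functional \<open>m ((T ^^ n) x)\<close>.\<close>

lemma cone_contraction_iterate:
  fixes T :: "'a::complex_normed_vector \<Rightarrow> 'a"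
  assumes T: "bounded_clinear T" "T ` (C - {0}) \<subseteq> C - {0}"
    and dist: "\<And>a b. a \<in> T ` (C - {0}) \<Longrightarrow> b \<in> T ` (C - {0}) \<Longrightarrow> cone_dist C a b < ennreal L" "0 \<le> L"
    and C: "\<And>c x. x \<in> C \<Longrightarrow> c *\<^sub>C x \<in> C"
    and W: "complex_vector.subspace W"
    and m: "functional_on ((T ^^ n) ` W) m" "\<And>u. u \<in> C \<inter> (T ^^ n) ` W - {0} \<Longrightarrow> m u \<noteq> 0"
    and d: "\<And>u v. u \<in> C \<inter> (T ^^ n) ` W - {0} \<Longrightarrow> v \<in> C \<inter> (T ^^ n) ` W - {0} \<Longrightarrow>
              norm (inverse (m u) *\<^sub>C u - inverse (m v) *\<^sub>C v) \<le> d"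
    and u: "u \<in> C \<inter> W - {0}" and v: "v \<in> C \<inter> W - {0}"
  shows "norm (inverse (m ((T ^^ n) u)) *\<^sub>C (T ^^ n) u - inverse (m ((T ^^ n) v)) *\<^sub>C (T ^^ n) v)
           \<le> ((exp L - 1) / (exp L + 1)) ^ n * d"
  using W m d u v
proof (induction n arbitrary: W u v)
  case 0
  then show ?case by (simp add: image_id)
next
  case (Suc n)
  have im: "(T ^^ n) ` T ` W = (T ^^ Suc n) ` W"
    by (simp add: image_image funpow_swap1)
  have lin: "(T ^^ n) (x + y) = (T ^^ n) x + (T ^^ n) y" "(T ^^ n) (x - y) = (T ^^ n) x - (T ^^ n) y"
      "(T ^^ n) (c *\<^sub>C x) = c *\<^sub>C (T ^^ n) x" for x y c
    using bounded_clinear_funpow[OF T(1), of n]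
    by (auto simp: bounded_clinear_iff bounded_linear.linear linear_add linear_diff)
  have mapsn: "(T ^^ n) x \<in> C - {0}" if "x \<in> C - {0}" for x
    using that T(2) by (induction n) auto
  have IH: "norm (inverse (m ((T ^^ n) u)) *\<^sub>C (T ^^ n) u - inverse (m ((T ^^ n) v)) *\<^sub>C (T ^^ n) v)
      \<le> ((exp L - 1) / (exp L + 1)) ^ n * d"
    if "u \<in> C \<inter> T ` W - {0}" "v \<in> C \<inter> T ` W - {0}" for u v
    by (rule Suc.IH[OF bounded_clinear_subspace_image[OF T(1) Suc.prems(1)], unfolded im, OF Suc.prems(2,3,4) that])
  have "norm ((T ^^ n) (inverse (m ((T ^^ n) (T u))) *\<^sub>C T u - inverse (m ((T ^^ n) (T v))) *\<^sub>C T v))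
      \<le> (exp L - 1) / (exp L + 1) * (((exp L - 1) / (exp L + 1)) ^ n * d)"
  proof (rule cone_contraction_step[OF T dist C Suc.prems(1), where q = "\<lambda>x. norm ((T ^^ n) x)" and m = "\<lambda>x. m ((T ^^ n) x)"])
    show "functional_on (T ` W) (\<lambda>x. m ((T ^^ n) x))"
      using Suc.prems(2) unfolding functional_on_def lin im[symmetric] by blast
    show "m ((T ^^ n) x) \<noteq> 0" if "x \<in> C \<inter> T ` W - {0}" for x
      using that mapsn[of x] Suc.prems(3)[of "(T ^^ n) x"] unfolding im[symmetric] by blast
    show "norm ((T ^^ n) (inverse (m ((T ^^ n) x)) *\<^sub>C x - inverse (m ((T ^^ n) y)) *\<^sub>C y))
       \<le> ((exp L - 1) / (exp L + 1)) ^ n * d" if "x \<in> C \<inter> T ` W - {0}" "y \<in> C \<inter> T ` W - {0}" for x y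
      using IH[OF that] by (simp add: lin)
  qed (use Suc.prems in \<open>auto simp: lin norm_scaleC\<close>)
  then show ?case
    by (simp add: lin funpow_swap1 mult.assoc)
qed

text \<open>Bounded aperture on the span of the two iterates gives a functional of norm
  \<open>M\<close> whose unit section of \<open>C\<close> lies in the ball of radius
  \<open>K / M\<close>, so the diameter to be contracted is at most \<open>2 * (K / M)\<close>.
  Undoing the normalization costs a factor \<open>cmod (m A) \<le> M * norm A\<close>, which cancels
  \<open>M\<close>; the witness is \<open>c = m A / m B\<close>.\<close>

lemma cone_iterates_collinear:
  fixes T :: "'a::complex_normed_vector \<Rightarrow> 'a"
  assumes T: "bounded_clinear T" "T ` (C - {0}) \<subseteq> C - {0}"
    and dist: "\<And>a b. a \<in> T ` (C - {0}) \<Longrightarrow> b \<in> T ` (C - {0}) \<Longrightarrow> cone_dist C a b < ennreal L" "0 \<le> L"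
    and C: "\<And>c x. x \<in> C \<Longrightarrow> c *\<^sub>C x \<in> C"
    and K: "bounded_sectional_aperture K C" "1 \<le> K"
    and ab: "a \<in> C - {0}" "b \<in> C - {0}"
  shows "\<exists>c. norm ((T ^^ n) a - c *\<^sub>C (T ^^ n) b)
           \<le> 2 * K * ((exp L - 1) / (exp L + 1)) ^ n * norm ((T ^^ n) a)"
proof -
  define A where "A = (T ^^ n) a"
  define B where "B = (T ^^ n) b"
  define S where "S = cspan {A, B}"
  have mapsn: "(T ^^ n) x \<in> C - {0}" if "x \<in> C - {0}" for x
    using that T(2) by (induction n) auto
  have AB: "A \<in> C - {0}" "B \<in> C - {0}"
    using mapsn ab by (auto simp: A_def B_def)
  have lin: "(T ^^ n) (x + y) = (T ^^ n) x + (T ^^ n) y" "(T ^^ n) (c *\<^sub>C x) = c *\<^sub>C (T ^^ n) x" for x y c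
    using bounded_clinear_funpow[OF T(1), of n]
    by (auto simp: bounded_clinear_iff bounded_linear.linear linear_add)
  have im: "(T ^^ n) ` cspan {a, b} \<subseteq> S"
    by (auto simp: S_def cspan_pair_iff A_def B_def lin) blast
  have "\<not> (A = 0 \<and> B = 0)" using AB by blast
  then obtain m where m: "functional_on S m" "\<exists>u\<in>S. m u \<noteq> 0"
    and mK: "\<And>u. u \<in> S \<inter> C \<Longrightarrow> cmod (m u) \<ge> 1 / K * norm u * functional_norm S m"
    using K(1) unfolding bounded_sectional_aperture_def S_def by metis
  define M where "M = functional_norm S m"
  obtain B0 where "0 \<le> B0" and B0: "\<And>u. u \<in> S \<Longrightarrow> cmod (m u) \<le> B0 * norm u"
    using functional_on_cspan_pair_bounded[OF m(1)[unfolded S_def]] by (auto simp: S_def)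
  \<comment> \<open>Boundedness is what makes the supremum in \<open>functional_norm\<close> an
    upper bound.\<close>
  have bdd: "bdd_above ((\<lambda>u. cmod (m u) / norm u) ` S)"
  proof (rule bdd_aboveI2)
    fix u assume "u \<in> S"
    then show "cmod (m u) / norm u \<le> B0"
      using B0[of u] \<open>0 \<le> B0\<close> by (cases "u = 0") (auto simp: pos_divide_le_eq)
  qed
  have m0: "m 0 = 0"
    using m(1) AB by (force simp: functional_on_def S_def dest: spec[of _ 0] intro: complex_vector.span_zero)
  have Mle: "cmod (m u) \<le> M * norm u" if "u \<in> S" for u
  proof (cases "u = 0")
    case False
    have "cmod (m u) / norm u \<le> M"
      unfolding M_def functional_norm_def by (rule cSUP_upper[OF that bdd])
    then show ?thesis using False by (simp add: pos_divide_le_eq)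
  qed (simp add: m0)
  obtain u0 where u0: "u0 \<in> S" "m u0 \<noteq> 0" using m(2) by blast
  have M: "M > 0"
    using Mle[OF u0(1)] u0(2) by (metis mult_nonpos_nonneg norm_ge_zero not_le order.trans zero_less_norm_iff)
  have K0: "K > 0" using K(2) by simp
  have mlow: "norm u \<le> K / M * cmod (m u)" if "u \<in> S \<inter> C" for u
    using mK[OF that] M K0 by (simp add: M_def[symmetric] field_simps)
  have mnz: "m u \<noteq> 0" if "u \<in> C \<inter> S - {0}" for u
    using mlow[of u] that by auto
  have unit: "norm (inverse (m u) *\<^sub>C u) \<le> K / M" if "u \<in> C \<inter> S - {0}" for u
    using mlow[of u] mnz[OF that] that by (simp add: norm_scaleC norm_inverse norm_divide field_simps)
  have "norm (inverse (m A) *\<^sub>C A - inverse (m B) *\<^sub>C B) \<le> ((exp L - 1) / (exp L + 1)) ^ n * (2 * (K / M))"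
    unfolding A_def B_def
  proof (rule cone_contraction_iterate[OF T dist C])
    show "complex_vector.subspace (cspan {a, b})" by (rule complex_vector.subspace_span)
    show "functional_on ((T ^^ n) ` cspan {a, b}) m"
      using m(1) im unfolding functional_on_def by blast
    show "m u \<noteq> 0" if "u \<in> C \<inter> (T ^^ n) ` cspan {a, b} - {0}" for u
      using mnz im that by blast
    show "norm (inverse (m u) *\<^sub>C u - inverse (m v) *\<^sub>C v) \<le> 2 * (K / M)"
      if "u \<in> C \<inter> (T ^^ n) ` cspan {a, b} - {0}" "v \<in> C \<inter> (T ^^ n) ` cspan {a, b} - {0}" for u v
    proof -
      have "u \<in> C \<inter> S - {0}" "v \<in> C \<inter> S - {0}" using im that by blast+
      then show ?thesis
        using norm_triangle_ineq4[of "inverse (m u) *\<^sub>C u" "inverse (m v) *\<^sub>C v"] unit[of u] unit[of v] by linarith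
    qed
  qed (use ab in \<open>auto intro: complex_vector.span_base\<close>)
  moreover have "norm (A - (m A / m B) *\<^sub>C B) = cmod (m A) * norm (inverse (m A) *\<^sub>C A - inverse (m B) *\<^sub>C B)"
  proof -
    have "m A \<noteq> 0" using mnz[of A] AB by (auto simp: S_def intro: complex_vector.span_base)
    then have "A - (m A / m B) *\<^sub>C B = m A *\<^sub>C (inverse (m A) *\<^sub>C A - inverse (m B) *\<^sub>C B)"
      by (simp add: complex_vector.scale_right_diff_distrib scaleC_scaleC scaleC_one divide_inverse)
    then show ?thesis by (simp add: norm_scaleC)
  qed
  ultimately have "norm (A - (m A / m B) *\<^sub>C B) \<le> cmod (m A) * (((exp L - 1) / (exp L + 1)) ^ n * (2 * (K / M)))"
    by (metis mult_left_mono norm_ge_zero)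
  also have "\<dots> \<le> (M * norm A) * (((exp L - 1) / (exp L + 1)) ^ n * (2 * (K / M)))"
    using K0 M dist(2)
    by (intro mult_right_mono Mle) (auto simp: S_def add_pos_pos less_imp_le intro!: complex_vector.span_base mult_nonneg_nonneg zero_le_power divide_nonneg_pos)
  also have "\<dots> = 2 * K * ((exp L - 1) / (exp L + 1)) ^ n * norm A"
    using M by simp
  finally show ?thesis unfolding A_def B_def by blast
qed

section \<open>Dominant eigenvalue and spectral gap\<close>

text \<open>By telescoping, the distance to the limit is at most the tail of a geometric
  series.\<close>

lemma convergent_of_geometric_increments:
  fixes f :: "nat \<Rightarrow> 'a::banach"
  assumes inc: "\<And>n. norm (f (Suc n) - f n) \<le> B * \<sigma> ^ n" and \<sigma>: "0 \<le> \<sigma>" "\<sigma> < 1"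
  obtains z where "f \<longlonglongrightarrow> z" "\<And>n. norm (f n - z) \<le> B * \<sigma> ^ n / (1 - \<sigma>)"
proof -
  define g where "g n = f (Suc n) - f n" for n
  have B: "(\<lambda>k. B * \<sigma> ^ (k + n)) sums (B * \<sigma> ^ n / (1 - \<sigma>))" for n
    using sums_mult[OF geometric_sums[of \<sigma>], of "B * \<sigma> ^ n"] \<sigma> by (simp add: power_add mult_ac)
  have ng: "summable (\<lambda>k. norm (g (k + n)))" for n
    using inc[of "_ + n"] by (intro summable_comparison_test'[OF sums_summable[OF B[of n]], of 0]) (auto simp: g_def)
  define z where "z = f 0 + suminf g"
  have tel: "f n = f 0 + (\<Sum>k<n. g k)" for n
    by (simp add: g_def sum_lessThan_telescope)
  have sg: "summable g" using summable_norm_cancel[OF ng[of 0, simplified]] .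
  have "(\<lambda>n. f 0 + (\<Sum>k<n. g k)) \<longlonglongrightarrow> z"
    unfolding z_def by (intro tendsto_intros summable_LIMSEQ sg)
  then have "f \<longlonglongrightarrow> z" by (simp flip: tel)
  moreover have "norm (f n - z) \<le> B * \<sigma> ^ n / (1 - \<sigma>)" for n
  proof -
    have "z - f n = (\<Sum>k. g (k + n))"
      using suminf_split_initial_segment[OF sg, of n] by (simp add: z_def tel[of n])
    then have "norm (f n - z) = norm (\<Sum>k. g (k + n))" by (metis norm_minus_commute)
    also have "\<dots> \<le> (\<Sum>k. norm (g (k + n)))" by (rule summable_norm[OF ng])
    also have "\<dots> \<le> (\<Sum>k. B * \<sigma> ^ (k + n))"
      using inc[of "_ + n"] by (intro suminf_le ng sums_summable[OF B]) (simp add: g_def)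
    also have "\<dots> = B * \<sigma> ^ n / (1 - \<sigma>)" using sums_unique[OF B] by simp
    finally show ?thesis .
  qed
  ultimately show ?thesis by (rule that)
qed

text \<open>Scaling a unit vector is isometric in the coefficient, so convergence of the multiples
  makes the coefficients Cauchy.\<close>

lemma limit_on_complex_line:
  fixes h :: "'a::complex_normed_vector"
  assumes "(\<lambda>n. c n *\<^sub>C h) \<longlonglongrightarrow> z" "norm h = 1"
  obtains a where "c \<longlonglongrightarrow> a" "z = a *\<^sub>C h"
proof -
  have "dist (c m) (c n) = dist (c m *\<^sub>C h) (c n *\<^sub>C h)" for m n
    using assms(2) by (simp add: dist_norm norm_scaleC flip: complex_vector.scale_left_diff_distrib)
  then have "Cauchy c"
    using LIMSEQ_imp_Cauchy[OF assms(1)] by (simp add: Cauchy_def)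
  then obtain a where a: "c \<longlonglongrightarrow> a"
    using Cauchy_convergent_iff convergent_def by blast
  then have "(\<lambda>n. c n *\<^sub>C h) \<longlonglongrightarrow> a *\<^sub>C h"
    by (intro scaleC.tendsto tendsto_const)
  with assms(1) a that show ?thesis using LIMSEQ_unique by blast
qed

text \<open>The map sending \<open>x\<close> to \<open>\<nu> x *\<^sub>C h\<close> is a rank-one
  projection commuting with \<open>T\<close>. On its complement the powers of \<open>T\<close> decay
  like \<open>\<rho> ^ n\<close>, so a Neumann series converges outside the disk of radius
  \<open>\<rho>\<close>; on its range \<open>T\<close> is multiplication by \<open>l\<close>. The
  resolvent is therefore explicit, and so are the spectrum outside that disk and the Riesz
  projection at \<open>l\<close>.\<close>

lemma has_spectral_gapI:
  fixes T :: "'a::complex_banach \<Rightarrow> 'a" and \<nu> :: "'a \<Rightarrow> complex"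
  assumes T: "bounded_clinear T" and h: "T h = l *\<^sub>C h" "norm h = 1"
    and \<nu>: "\<And>x y. \<nu> (x + y) = \<nu> x + \<nu> y" "\<And>c x. \<nu> (c *\<^sub>C x) = c * \<nu> x" "\<And>x. \<nu> (T x) = l * \<nu> x" "\<nu> h = 1"
    and \<nu>_bd: "\<And>x. cmod (\<nu> x) \<le> D * norm x"
    and \<rho>: "0 \<le> \<rho>" "\<rho> < cmod l"
    and decay: "\<And>n x. norm ((T ^^ n) (x - \<nu> x *\<^sub>C h)) \<le> B * \<rho> ^ n * norm x"
  shows "has_spectral_gap T"
proof -
  have Tbl: "bounded_linear T" and Tsc: "T (c *\<^sub>C x) = c *\<^sub>C T x" for c x
    using T by (auto simp: bounded_clinear_iff)
  have Tn: "bounded_linear (T ^^ n)" "(T ^^ n) (c *\<^sub>C x) = c *\<^sub>C (T ^^ n) x" for n c x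
    using bounded_clinear_funpow[OF T, of n] by (auto simp: bounded_clinear_iff)
  note Tlin = linear_add[OF bounded_linear.linear[OF Tbl]] linear_diff[OF bounded_linear.linear[OF Tbl]]
  define P where "P x = x - \<nu> x *\<^sub>C h" for x
  have P: "P (x + y) = P x + P y" "P (c *\<^sub>C x) = c *\<^sub>C P x" "P (T x) = T (P x)" for x y c
    by (simp_all add: P_def \<nu> Tlin Tsc h scaleC_add_left complex_vector.scale_right_diff_distrib scaleC_scaleC mult.commute)
  have B: "norm ((T ^^ n) (P x)) \<le> B * \<rho> ^ n * norm x" for n x
    using decay by (simp add: P_def)
  \<comment> \<open>The terms of the Neumann series for the resolvent of \<open>T\<close> on the
    range of the complementary projection \<open>P\<close>.\<close>
  define s where "s z x = (\<lambda>n. inverse z ^ Suc n *\<^sub>C (T ^^ n) (P x))" for z x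
  define S where "S z x = (\<Sum>n. s z x n)" for z x
  \<comment> \<open>The bound uses \<open>r\<close> instead of \<open>cmod z\<close> so that it is
    uniform over the circle in the contour integral below.\<close>
  have s_le: "norm (s z x n) \<le> (\<rho> / r) ^ n * (B * norm x / r)" if "r \<le> cmod z" "\<rho> < r" for z x n r
  proof -
    have r: "0 < r" using that \<rho> by simp
    have "norm (s z x n) = inverse (cmod z) ^ Suc n * norm ((T ^^ n) (P x))"
      by (simp add: s_def norm_scaleC norm_power norm_inverse norm_mult)
    also have "\<dots> \<le> inverse r ^ Suc n * (B * \<rho> ^ n * norm x)"
      using that r by (intro mult_mono B power_mono le_imp_inverse_le) auto
    also have "\<dots> = (\<rho> / r) ^ n * (B * norm x / r)"
      by (simp add: divide_inverse power_mult_distrib mult_ac)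
    finally show ?thesis .
  qed
  have geo: "summable (\<lambda>n. (\<rho> / r) ^ n * c)" if "\<rho> < r" for r c
    using \<rho> that by (intro summable_mult2 summable_geometric) (auto simp: abs_of_nonneg)
  have s_summable: "summable (\<lambda>n. norm (s z x n))" if "\<rho> < cmod z" for z x
    using s_le[OF order.refl that, of x]
    by (intro summable_comparison_test'[OF geo[OF that, of "B * norm x / cmod z"], of 0]) auto
  have s_sums: "s z x sums S z x" if "\<rho> < cmod z" for z x
    using s_summable[OF that] by (simp add: S_def summable_norm_cancel summable_sums)
  have S_lin: "S z (x + y) = S z x + S z y" "S z (c *\<^sub>C x) = c *\<^sub>C S z x" "S z (T x) = T (S z x)"
    if z: "\<rho> < cmod z" for z x y c
  proof -
    have "s z (x + y) = (\<lambda>n. s z x n + s z y n)"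
      by (simp add: s_def P scaleC_add_right linear_add[OF bounded_linear.linear[OF Tn(1)]])
    then have "s z (x + y) sums (S z x + S z y)"
      using sums_add[OF s_sums[OF z] s_sums[OF z]] by metis
    then show "S z (x + y) = S z x + S z y" by (rule sums_unique2[OF s_sums[OF z]])
    have "s z (c *\<^sub>C x) = (\<lambda>n. c *\<^sub>C s z x n)"
      by (simp add: s_def P Tn(2) scaleC_scaleC mult_ac)
    then have "s z (c *\<^sub>C x) sums (c *\<^sub>C S z x)"
      using bounded_linear.sums[OF scaleC.bounded_linear_right s_sums[OF z]] by metis
    then show "S z (c *\<^sub>C x) = c *\<^sub>C S z x" by (rule sums_unique2[OF s_sums[OF z]])
    have "s z (T x) = (\<lambda>n. T (s z x n))"
      by (simp add: s_def P Tsc funpow_swap1)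
    then have "s z (T x) sums T (S z x)"
      using bounded_linear.sums[OF Tbl s_sums[OF z]] by metis
    then show "S z (T x) = T (S z x)" by (rule sums_unique2[OF s_sums[OF z]])
  qed
  have S_eq: "z *\<^sub>C S z x - T (S z x) = P x" if z: "\<rho> < cmod z" for z x
  proof -
    have z0: "z \<noteq> 0" using z \<rho> by auto
    have 1: "(\<lambda>n. z *\<^sub>C s z x n) sums (z *\<^sub>C S z x)"
      by (intro bounded_linear.sums[OF scaleC.bounded_linear_right] s_sums z)
    have 2: "(\<lambda>n. T (s z x n)) sums T (S z x)"
      by (intro bounded_linear.sums[OF Tbl] s_sums z)
    \<comment> \<open>\<open>T\<close> shifts the series by one index, so in
      \<open>z *\<^sub>C S z x - T (S z x)\<close> only the zeroth term \<open>P x\<close>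
      survives.\<close>
    have "T (s z x n) = z *\<^sub>C s z x (Suc n)" for n
      using z0 by (simp add: s_def Tsc scaleC_scaleC)
    with 2 have "(\<lambda>n. z *\<^sub>C s z x (Suc n)) sums T (S z x)" by simp
    then have "(\<lambda>n. z *\<^sub>C s z x n) sums (T (S z x) + z *\<^sub>C s z x 0)"
      by (subst (asm) sums_Suc_iff) simp
    moreover have "z *\<^sub>C s z x 0 = P x"
      using z0 by (simp add: s_def scaleC_scaleC scaleC_one)
    ultimately have "z *\<^sub>C S z x = T (S z x) + P x"
      using sums_unique2[OF 1] by simp
    then show ?thesis by simp
  qed
  have S_bd: "\<exists>E. \<forall>x. norm (S z x) \<le> E * norm x" if z: "\<rho> < cmod z" for z
  proof (intro exI allI)
    fix x
    have q: "\<rho> / cmod z < 1" using z \<rho> by (subst divide_less_eq_1_pos) auto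
    have "norm (S z x) \<le> (\<Sum>n. norm (s z x n))"
      unfolding S_def by (rule summable_norm[OF s_summable[OF z]])
    also have "\<dots> \<le> (\<Sum>n. (\<rho> / cmod z) ^ n * (B * norm x / cmod z))"
      by (intro suminf_le s_le s_summable geo z order.refl)
    also have "\<dots> = ((\<Sum>n. (\<rho> / cmod z) ^ n) * B / cmod z) * norm x"
      using q \<rho> by (subst suminf_mult2[symmetric]) (auto intro!: summable_geometric simp: abs_of_nonneg)
    finally show "norm (S z x) \<le> ((\<Sum>n. (\<rho> / cmod z) ^ n) * B / cmod z) * norm x" .
  qed
  define R where "R z x = (\<nu> x / (z - l)) *\<^sub>C h + S z x" for z x
  have res: "z \<in> resolvent_set T" "resolvent T z = R z" if z: "\<rho> < cmod z" "z \<noteq> l" for z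
  proof -
    \<comment> \<open>Commuting with \<open>T\<close> turns the right inverse \<open>R z\<close>
      into a two-sided inverse.\<close>
    have TR: "R z (T x) = T (R z x)" for x
      by (simp add: R_def \<nu> S_lin z Tlin Tsc h scaleC_scaleC mult.commute)
    have Rlin: "R z (x + y) = R z x + R z y" "R z (c *\<^sub>C x) = c *\<^sub>C R z x" for x y c
      by (simp_all add: R_def \<nu> S_lin z scaleC_add_left scaleC_add_right scaleC_scaleC add_divide_distrib)
    have right: "z *\<^sub>C R z x - T (R z x) = x" for x
    proof -
      have "z *\<^sub>C R z x - T (R z x) = (z * (\<nu> x / (z - l)) - \<nu> x / (z - l) * l) *\<^sub>C h + P x"
        by (simp add: R_def Tlin Tsc h scaleC_add_right scaleC_scaleC complex_vector.scale_left_diff_distrib flip: S_eq[OF z(1)])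
      also have "z * (\<nu> x / (z - l)) - \<nu> x / (z - l) * l = (z - l) * (\<nu> x / (z - l))"
        by (simp only: left_diff_distrib mult.commute)
      also have "\<dots> = \<nu> x"
        using z(2) by simp
      finally show ?thesis by (simp add: P_def)
    qed
    have "R z (z *\<^sub>C x - T x) = x" for x
    proof -
      have "R z (z *\<^sub>C x - T x) = z *\<^sub>C R z x - R z (T x)"
        using Rlin(1)[of "z *\<^sub>C x - T x" "T x"] Rlin(2)[of z x] by (simp add: eq_diff_eq)
      then show ?thesis using right TR by simp
    qed
    then have comp: "(\<lambda>x. z *\<^sub>C x - T x) \<circ> R z = id" "R z \<circ> (\<lambda>x. z *\<^sub>C x - T x) = id"
      using right by (simp_all add: fun_eq_iff)
    note bij = o_bij[OF comp(2,1)] and inv = inv_unique_comp[OF comp]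
    show "resolvent T z = R z" by (simp add: resolvent_def inv)
    obtain E where E: "\<And>x. norm (S z x) \<le> E * norm x" using S_bd[OF z(1)] by blast
    have "norm (R z x) \<le> norm x * (D / cmod (z - l) + E)" for x
    proof -
      have "norm (R z x) \<le> cmod (\<nu> x) / cmod (z - l) + norm (S z x)"
        unfolding R_def by (rule order.trans[OF norm_triangle_ineq]) (simp add: norm_scaleC norm_divide h)
      also have "\<dots> \<le> D * norm x / cmod (z - l) + E * norm x"
        by (intro add_mono divide_right_mono \<nu>_bd E) auto
      finally show ?thesis by (simp add: algebra_simps)
    qed
    then have "bounded_clinear (R z)"
      unfolding bounded_clinear_def Vector_Spaces.linear_iff
      by (intro conjI complex_vector.vector_space_axioms) (auto simp: Rlin)
    then show "z \<in> resolvent_set T"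
      by (simp add: resolvent_set_def bij inv)
  qed
  have h0: "h \<noteq> 0" using h(2) by auto
  have "\<not> inj (\<lambda>x. l *\<^sub>C x - T x)"
    using injD[of "\<lambda>x. l *\<^sub>C x - T x" h 0] h0 h(1) linear_0[OF bounded_linear.linear[OF Tbl]] by auto
  then have l_spec: "l \<in> spectrum T"
    by (auto simp: spectrum_def resolvent_set_def bij_def)
  have spec: "spectrum T \<subseteq> insert l (cball 0 \<rho>)"
    using res(1) unfolding spectrum_def subset_iff by (metis Compl_iff insertCI mem_cball_0 not_le)
  have sr: "spectral_radius T = cmod l"
    unfolding spectral_radius_def using l_spec spec \<rho> by (intro cSup_eq_maximum) auto
  \<comment> \<open>Half the gap: the closed disk about \<open>l\<close> then stays outside the
    circle of radius \<open>r\<close>, which lies strictly beyond \<open>\<rho>\<close>, so it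
    avoids 0 and the rest of the spectrum.\<close>
  define \<epsilon> where "\<epsilon> = (cmod l - \<rho>) / 2"
  define r where "r = cmod l - \<epsilon>"
  have \<epsilon>: "\<epsilon> > 0" "\<epsilon> < cmod l" and r: "\<rho> < r"
    using \<rho> by (auto simp: \<epsilon>_def r_def field_simps)
  have far: "r \<le> cmod z" if "cmod (z - l) \<le> \<epsilon>" for z
    using that norm_triangle_ineq2[of l z] by (simp add: r_def norm_minus_commute)
  have "spectrum T \<inter> cball l \<epsilon> = {l}"
    using l_spec spec \<epsilon> far r by (force simp: dist_norm norm_minus_commute)
  moreover have "riesz_projection T l \<epsilon> x = \<nu> x *\<^sub>C h" for x
  proof -
    let ?g = "circlepath l \<epsilon>"
    define g' where "g' t = vector_derivative ?g (at t)" for t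
    have g: "?g t \<noteq> l" "r \<le> cmod (?g t)" "cmod (?g t - l) = \<epsilon>" for t
    proof -
      show "cmod (?g t - l) = \<epsilon>" using \<epsilon> by (simp add: circlepath norm_mult)
      then show "?g t \<noteq> l" "r \<le> cmod (?g t)" using \<epsilon> far by auto
    qed
    have g': "g' t = 2 * pi * \<i> * (?g t - l)" for t
      by (simp add: g'_def vector_derivative_circlepath) (simp add: circlepath)
    \<comment> \<open>The contribution of the \<open>n\<close>-th Neumann term to the contour
      integral. It vanishes because negative powers of \<open>z\<close> are holomorphic on
      \<open>ball l (cmod l)\<close>, a disk that omits 0 and contains the circle.\<close>
    define f where "f n = (\<lambda>t. (g' t * inverse (?g t) ^ Suc n) *\<^sub>C (T ^^ n) (P x))" for n
    have f_int: "(f n has_integral 0) {0..1}" for n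
    proof -
      have "((\<lambda>z. inverse z ^ Suc n) has_contour_integral 0) ?g"
      proof (rule Cauchy_theorem_disc_simple)
        show "(\<lambda>z. inverse z ^ Suc n) holomorphic_on ball l (cmod l)"
          by (intro holomorphic_intros) auto
        show "path_image ?g \<subseteq> ball l (cmod l)"
          using \<epsilon> by (simp add: path_image_circlepath sphere_def subset_iff)
      qed auto
      then have "((\<lambda>t. inverse (?g t) ^ Suc n * g' t) has_integral 0) {0..1}"
        by (simp add: has_contour_integral g'_def)
      from has_integral_linear[OF this scaleC.bounded_linear_left[of "(T ^^ n) (P x)"]]
      show ?thesis by (simp add: f_def o_def mult.commute)
    qed
    have "continuous_on {0..1} ?g"
      using path_circlepath by (simp add: path_def)
    moreover have "?g t \<noteq> 0" for t
      using g(2)[of t] r \<rho>(1) by auto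
    ultimately have f_cont: "continuous_on {0..1} (f n)" for n
      unfolding f_def g' by (intro scaleC.continuous_on continuous_intros) auto
    have f_eq: "f n t = g' t *\<^sub>C s (?g t) x n" for n t
      by (simp add: f_def s_def scaleC_scaleC)
    \<comment> \<open>Uniform convergence along the circle lets the sum and the integral be
      interchanged, so the whole Neumann part integrates to 0.\<close>
    have "uniform_limit {0..1} (\<lambda>N t. \<Sum>n<N. f n t) (\<lambda>t. \<Sum>n. f n t) sequentially"
    proof (rule Weierstrass_m_test)
      fix n t
      have "norm (f n t) = 2 * pi * \<epsilon> * norm (s (?g t) x n)"
        using \<epsilon> by (simp add: f_eq g' norm_scaleC norm_mult g(3))
      also have "\<dots> \<le> 2 * pi * \<epsilon> * ((\<rho> / r) ^ n * (B * norm x / r))"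
        using \<epsilon> by (intro mult_left_mono s_le g r) auto
      finally show "norm (f n t) \<le> 2 * pi * \<epsilon> * ((\<rho> / r) ^ n * (B * norm x / r))" .
      show "summable (\<lambda>n. 2 * pi * \<epsilon> * ((\<rho> / r) ^ n * (B * norm x / r)))"
        by (intro summable_mult geo r)
    qed
    then obtain I J where IJ: "\<And>N. ((\<lambda>t. \<Sum>n<N. f n t) has_integral I N) {0..1}"
        "((\<lambda>t. \<Sum>n. f n t) has_integral J) {0..1}" "I \<longlonglongrightarrow> J"
      by (rule uniform_limit_integral) (auto intro!: continuous_intros f_cont)
    have "((\<lambda>t. \<Sum>n<N. f n t) has_integral (\<Sum>n<N. 0)) {0..1}" for N
      by (intro has_integral_sum f_int) auto
    then have "I N = 0" for N
      using has_integral_unique[OF IJ(1)[of N]] by auto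
    then have "I = (\<lambda>_. 0)" by blast
    with IJ(3) have "J = 0"
      by (simp add: LIMSEQ_const_iff)
    moreover have "(\<Sum>n. f n t) = g' t *\<^sub>C S (?g t) x" for t
      unfolding f_eq using g(2)[of t] r
      by (intro sums_unique[symmetric] bounded_linear.sums[OF scaleC.bounded_linear_right] s_sums) auto
    ultimately have S_int: "((\<lambda>t. g' t *\<^sub>C S (?g t) x) has_integral 0) {0..1}"
      using IJ(2) by simp
    \<comment> \<open>The pole part: the velocity of the circle is \<open>2 * pi * \<i>\<close>
      times \<open>?g t - l\<close>, which cancels the denominator and leaves a constant
      integrand.\<close>
    have "((\<lambda>t::real. (2 * pi * \<i> * \<nu> x) *\<^sub>C h) has_integral (2 * pi * \<i> * \<nu> x) *\<^sub>C h) {0..1}"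
      using has_integral_const_real[of "(2 * pi * \<i> * \<nu> x) *\<^sub>C h" 0 1] by simp
    from has_integral_add[OF this S_int]
    have "((\<lambda>t. (2 * pi * \<i> * \<nu> x) *\<^sub>C h + g' t *\<^sub>C S (?g t) x) has_integral (2 * pi * \<i> * \<nu> x) *\<^sub>C h) {0..1}"
      by (simp only: add_0_right)
    moreover have "(2 * pi * \<i> * \<nu> x) *\<^sub>C h + g' t *\<^sub>C S (?g t) x = g' t *\<^sub>C resolvent T (?g t) x" for t
    proof -
      have "g' t * (\<nu> x / (?g t - l)) = 2 * pi * \<i> * \<nu> x"
        using g(1)[of t] by (simp add: g')
      moreover have "resolvent T (?g t) x = (\<nu> x / (?g t - l)) *\<^sub>C h + S (?g t) x"
        using res(2)[of "?g t"] g[of t] r by (simp add: R_def)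
      ultimately show ?thesis
        by (simp add: scaleC_add_right scaleC_scaleC)
    qed
    ultimately have "integral {0..1} (\<lambda>t. g' t *\<^sub>C resolvent T (?g t) x) = (2 * pi * \<i> * \<nu> x) *\<^sub>C h"
      by (simp add: integral_unique)
    then show ?thesis
      by (simp add: riesz_projection_def g'_def scaleC_scaleC)
  qed
  moreover have "cdim (range (\<lambda>x. \<nu> x *\<^sub>C h)) = 1"
  proof -
    have "range (\<lambda>x. \<nu> x *\<^sub>C h) = cspan {h}"
    proof -
      have "c *\<^sub>C h \<in> range (\<lambda>x. \<nu> x *\<^sub>C h)" for c
        using rangeI[of "\<lambda>x. \<nu> x *\<^sub>C h" "c *\<^sub>C h"] by (simp add: \<nu>)
      then show ?thesis unfolding complex_vector.span_singleton by blast
    qed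
    moreover have "\<not> cdependent {h}"
      using h0 by (simp add: complex_vector.dependent_single)
    ultimately show ?thesis
      using complex_vector.dim_eq_card_independent[of "{h}"] complex_vector.dim_span[of "{h}"] by simp
  qed
  ultimately have "spectrum T \<inter> cball l \<epsilon> = {l} \<and> cdim (range (riesz_projection T l \<epsilon>)) = 1"
    by (metis (no_types, lifting) ext)
  then have "simple_isolated_eigenvalue T l"
    unfolding simple_isolated_eigenvalue_def using h(1) h0 \<epsilon>(1) by blast
  then show ?thesis
    unfolding has_spectral_gap_def using sr \<rho> spec by (intro exI[of _ l] conjI exI[of _ \<rho>]) auto
qed

section \<open>Cones whose directions contract\<close>

text \<open>Isolates what the dynamical part takes from the cone: orbits in \<open>C\<close> become
  parallel at a geometric rate. The theorem instantiates \<open>\<sigma>\<close> with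
  \<open>tanh (L / 2)\<close> and \<open>M\<close> with \<open>2 * K\<close>.\<close>

locale collinear_iterates =
  fixes T :: "'a::complex_banach \<Rightarrow> 'a" and C :: "'a set" and \<sigma> M :: real
  assumes T: "bounded_clinear T" and C_closed: "closed C"
    and C_scale: "\<And>c x. x \<in> C \<Longrightarrow> c *\<^sub>C x \<in> C"
    and T_C: "\<And>x. x \<in> C - {0} \<Longrightarrow> T x \<in> C - {0}"
    and \<sigma>: "0 < \<sigma>" "\<sigma> < 1"
    and collinear: "\<And>a b n. a \<in> C - {0} \<Longrightarrow> b \<in> C - {0} \<Longrightarrow>
          \<exists>c. norm ((T ^^ n) a - c *\<^sub>C (T ^^ n) b) \<le> M * \<sigma> ^ n * norm ((T ^^ n) a)"
begin

lemma T_simps: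
  "T (x + y) = T x + T y" "T (x - y) = T x - T y" "T (c *\<^sub>C x) = c *\<^sub>C T x"
  "(T ^^ n) (x + y) = (T ^^ n) x + (T ^^ n) y" "(T ^^ n) (c *\<^sub>C x) = c *\<^sub>C (T ^^ n) x"
  using T bounded_clinear_funpow[OF T, of n]
  by (auto simp: bounded_clinear_iff bounded_linear.linear linear_add linear_diff)

lemma T_bounded_linear: "bounded_linear T" "bounded_linear (T ^^ n)"
  using T bounded_clinear_funpow[OF T, of n] by (auto simp: bounded_clinear_iff)

lemma T_norm_bound: "\<exists>B\<ge>0. \<forall>x. norm (T x) \<le> B * norm x"
  using bounded_linear.nonneg_bounded[OF T_bounded_linear(1)] by (metis mult.commute)

lemma funpow_T_C: "x \<in> C - {0} \<Longrightarrow> (T ^^ n) x \<in> C - {0}"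
  using T_C by (induction n) auto

lemma M_nonneg:
  assumes "x \<in> C - {0}" shows "0 \<le> M"
proof -
  obtain c where "norm (x - c *\<^sub>C x) \<le> M * norm x"
    using collinear[OF assms assms, of 0] by auto
  then have "0 \<le> M * norm x" by (meson norm_ge_zero order.trans)
  then show ?thesis using assms by (simp add: zero_le_mult_iff)
qed

text \<open>The lines through \<open>(T ^^ n) x\<close> converge, but unit vectors on them converge
  only with suitable phases. These are chosen one after another, so that successive unit vectors
  differ by at most \<open>2 * M * \<sigma> ^ n\<close>; the limit spans an invariant line.\<close>

lemma eigenvector_exists:
  assumes x: "x \<in> C - {0}"
  obtains h l where "h \<in> C" "norm h = 1" "l \<noteq> 0" "T h = l *\<^sub>C h"
proof -
  have "\<exists>e. \<forall>n. (norm (e n) = 1 \<and> (\<exists>s. e n = s *\<^sub>C (T ^^ n) x)) \<and> norm (e (Suc n) - e n) \<le> (2 * M) * \<sigma> ^ n"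
  proof (rule dependent_nat_choice)
    show "\<exists>e. norm e = 1 \<and> (\<exists>s. e = s *\<^sub>C (T ^^ 0) x)"
      using x by (intro exI[of _ "complex_of_real (inverse (norm x)) *\<^sub>C x"]) (auto simp: norm_scaleC norm_inverse)
    fix e n assume e: "norm e = 1 \<and> (\<exists>s. e = s *\<^sub>C (T ^^ n) x)"
    then obtain s where s: "e = s *\<^sub>C (T ^^ n) x" by blast
    have "s \<noteq> 0" using e s by auto
    \<comment> \<open>Comparing the orbits of \<open>s *\<^sub>C x\<close> and \<open>T x\<close> at
      time \<open>n\<close> compares \<open>e\<close> with the next iterate of
      \<open>x\<close>.\<close>
    then have "s *\<^sub>C x \<in> C - {0}" "T x \<in> C - {0}" using x C_scale T_C by auto
    from collinear[OF this, of n] obtain c where c: "norm (e - c *\<^sub>C (T ^^ n) (T x)) \<le> M * \<sigma> ^ n"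
      using e s by (auto simp: T_simps)
    \<comment> \<open>If \<open>c = 0\<close>, the estimate reads
      \<open>1 \<le> M * \<sigma> ^ n\<close>, and any unit vector on the next line is close enough;
      the coefficient 1 just keeps \<open>w\<close> nonzero.\<close>
    define w where "w = (if c = 0 then 1 else c) *\<^sub>C (T ^^ Suc n) x"
    have w0: "w \<noteq> 0" using funpow_T_C[OF x, of "Suc n"] by (auto simp: w_def)
    define e' where "e' = complex_of_real (inverse (norm w)) *\<^sub>C w"
    have e'1: "norm e' = 1" using w0 by (simp add: e'_def norm_scaleC norm_inverse)
    have "norm (e' - e) \<le> 2 * M * \<sigma> ^ n"
    proof (cases "c = 0")
      case True
      then have "1 \<le> M * \<sigma> ^ n" using c e by simp
      moreover have "norm (e' - e) \<le> 2" using norm_triangle_ineq4[of e' e] e e'1 by simp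
      ultimately show ?thesis by simp
    next
      case False
      then have ew: "norm (e - w) \<le> M * \<sigma> ^ n" using c by (simp add: w_def funpow_swap1)
      \<comment> \<open>Normalizing \<open>w\<close> moves it no further than its distance to the
        unit vector \<open>e\<close>; this accounts for the factor 2.\<close>
      have "e' - w = (inverse (norm w) - 1) *\<^sub>R w"
        unfolding e'_def scaleC_of_real by (simp add: scaleR_diff_left)
      then have "norm (e' - w) = \<bar>inverse (norm w) - 1\<bar> * norm w" by simp
      also have "\<dots> = \<bar>norm e - norm w\<bar>"
        using w0 e by (simp add: abs_mult_pos left_diff_distrib)
      also have "\<dots> \<le> norm (e - w)" by (rule norm_triangle_ineq3)
      finally have "norm (e' - w) \<le> norm (e - w)" .
      then show ?thesis
        using norm_triangle_ineq4[of "e' - w" "e - w"] ew by simp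
    qed
    moreover have "\<exists>s. e' = s *\<^sub>C (T ^^ Suc n) x"
      by (auto simp: e'_def w_def scaleC_scaleC)
    ultimately show "\<exists>e'. (norm e' = 1 \<and> (\<exists>s. e' = s *\<^sub>C (T ^^ Suc n) x)) \<and> norm (e' - e) \<le> 2 * M * \<sigma> ^ n"
      using e'1 by blast
  qed
  then obtain e where e1: "\<And>n. norm (e n) = 1" and es: "\<And>n. \<exists>s. e n = s *\<^sub>C (T ^^ n) x"
    and inc: "\<And>n. norm (e (Suc n) - e n) \<le> (2 * M) * \<sigma> ^ n" by blast
  obtain h where h: "e \<longlonglongrightarrow> h"
    using convergent_of_geometric_increments[OF inc] \<sigma> by (metis less_imp_le)
  have h1: "norm h = 1"
    using tendsto_norm[OF h] by (simp add: e1 LIMSEQ_const_iff)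
  have "e n \<in> C" for n using es[of n] funpow_T_C[OF x, of n] C_scale by auto
  then have hC: "h \<in> C" using C_closed h closed_sequentially by blast
  have "\<exists>t. T (e n) = t *\<^sub>C e (Suc n)" for n
  proof -
    obtain s s' where s: "e n = s *\<^sub>C (T ^^ n) x" "e (Suc n) = s' *\<^sub>C (T ^^ Suc n) x" using es by meson
    have "s' \<noteq> 0" using s(2) e1[of "Suc n"] by auto
    then have "T (e n) = (s / s') *\<^sub>C e (Suc n)" by (simp add: s T_simps scaleC_scaleC)
    then show ?thesis ..
  qed
  then obtain t where t: "\<And>n. T (e n) = t n *\<^sub>C e (Suc n)" by metis
  obtain B where B: "0 \<le> B" "\<And>x. norm (T x) \<le> B * norm x" using T_norm_bound by blast
  have tB: "cmod (t n) \<le> B" for n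
    using B(2)[of "e n"] e1[of n] e1[of "Suc n"] by (simp add: t norm_scaleC)
  have Th: "(\<lambda>n. T (e n)) \<longlonglongrightarrow> T h"
    by (intro bounded_linear.tendsto[OF T_bounded_linear(1)] h)
  \<comment> \<open>The multipliers \<open>t n\<close> are so far only known to be bounded. Their
    convergence follows once \<open>t n *\<^sub>C h\<close> is seen to have the limit
    \<open>T h\<close>.\<close>
  have "(\<lambda>n. t n *\<^sub>C h - T (e n)) \<longlonglongrightarrow> 0"
  proof (rule Lim_null_comparison)
    have "norm (t n *\<^sub>C h - T (e n)) \<le> B * norm (h - e (Suc n))" for n
      using tB[of n] by (simp add: t norm_scaleC mult_right_mono flip: complex_vector.scale_right_diff_distrib)
    then show "\<forall>\<^sub>F n in sequentially. norm (t n *\<^sub>C h - T (e n)) \<le> B * norm (h - e (Suc n))" by simp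
    have "(\<lambda>n. B * norm (h - e (Suc n))) \<longlonglongrightarrow> B * norm (h - h)"
      by (intro tendsto_intros LIMSEQ_Suc h)
    then show "(\<lambda>n. B * norm (h - e (Suc n))) \<longlonglongrightarrow> 0" by simp
  qed
  from tendsto_add[OF this Th] have "(\<lambda>n. t n *\<^sub>C h) \<longlonglongrightarrow> T h" by simp
  then obtain l where l: "T h = l *\<^sub>C h" using limit_on_complex_line[OF _ h1] by metis
  moreover have "h \<noteq> 0" using h1 by auto
  then have "l \<noteq> 0" using T_C[of h] hC l by auto
  ultimately show ?thesis using that hC h1 by blast
qed

text \<open>The rescaled orbit grows at most by a factor \<open>1 + D \<sigma>\<^sup>n\<close> in step \<open>n\<close>, and the product of these
  factors converges.\<close>
lemma cone_orbit_asymptotics: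
  assumes h: "h \<in> C" "norm h = 1" "l \<noteq> 0" "T h = l *\<^sub>C h"
  shows "\<exists>B\<ge>0. \<forall>y\<in>C - {0}. \<exists>a. \<forall>n. norm (inverse l ^ n *\<^sub>C (T ^^ n) y - a *\<^sub>C h) \<le> B * \<sigma> ^ n * norm y"
proof -
  have hC: "h \<in> C - {0}" using h by auto
  have M: "0 \<le> M" by (rule M_nonneg[OF hC])
  have Tnh: "(T ^^ n) h = l ^ n *\<^sub>C h" for n
    by (induction n) (simp_all add: T_simps h(4) scaleC_scaleC scaleC_one mult.commute)
  obtain B where B: "0 \<le> B" "\<And>x. norm (T x) \<le> B * norm x" using T_norm_bound by blast
  define D where "D = (B / cmod l + 1) * M"
  define E where "E = exp (D / (1 - \<sigma>))"
  have D: "0 \<le> D" using B M by (simp add: D_def)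
  have "\<exists>a. \<forall>n. norm (inverse l ^ n *\<^sub>C (T ^^ n) y - a *\<^sub>C h) \<le> D * E / (1 - \<sigma>) * \<sigma> ^ n * norm y"
    if y: "y \<in> C - {0}" for y
  proof -
    define Y where "Y n = inverse l ^ n *\<^sub>C (T ^^ n) y" for n
    have Y_Suc: "Y (Suc n) = inverse l *\<^sub>C T (Y n)" for n
      by (simp add: Y_def T_simps scaleC_scaleC)
    have "\<exists>c. norm (Y n - c *\<^sub>C h) \<le> M * \<sigma> ^ n * norm (Y n)" for n
    proof -
      obtain c where c: "norm ((T ^^ n) y - c *\<^sub>C (T ^^ n) h) \<le> M * \<sigma> ^ n * norm ((T ^^ n) y)"
        using collinear[OF y hC] by blast
      have "inverse l ^ n *\<^sub>C ((T ^^ n) y - c *\<^sub>C (T ^^ n) h) = Y n - c *\<^sub>C h"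
        using h(3) by (simp add: Y_def Tnh scaleC_scaleC complex_vector.scale_right_diff_distrib power_inverse)
      then have "norm (Y n - c *\<^sub>C h) = cmod (inverse l ^ n) * norm ((T ^^ n) y - c *\<^sub>C (T ^^ n) h)"
        by (metis norm_scaleC)
      also have "\<dots> \<le> cmod (inverse l ^ n) * (M * \<sigma> ^ n * norm ((T ^^ n) y))"
        using c by (intro mult_left_mono) auto
      also have "\<dots> = M * \<sigma> ^ n * norm (Y n)" by (simp add: Y_def norm_scaleC)
      finally show ?thesis ..
    qed
    then obtain c where c: "\<And>n. norm (Y n - c n *\<^sub>C h) \<le> M * \<sigma> ^ n * norm (Y n)" by metis
    \<comment> \<open>\<open>inverse l *\<^sub>C T\<close> fixes \<open>c n *\<^sub>C h\<close>, so
      \<open>Y n\<close> and \<open>Y (Suc n)\<close> are both close to that one vector; adding the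
      two errors produces the constant \<open>D\<close>.\<close>
    have inc: "norm (Y (Suc n) - Y n) \<le> D * \<sigma> ^ n * norm (Y n)" for n
    proof -
      have "Y (Suc n) - c n *\<^sub>C h = inverse l *\<^sub>C T (Y n - c n *\<^sub>C h)"
        using h(3) by (simp add: Y_Suc T_simps h(4) complex_vector.scale_right_diff_distrib scaleC_scaleC)
      then have "norm (Y (Suc n) - c n *\<^sub>C h) \<le> B / cmod l * norm (Y n - c n *\<^sub>C h)"
        using B(2)[of "Y n - c n *\<^sub>C h"] h(3) by (simp add: norm_scaleC norm_divide field_simps)
      then have "norm (Y (Suc n) - Y n) \<le> (B / cmod l + 1) * norm (Y n - c n *\<^sub>C h)"
        using norm_triangle_ineq4[of "Y (Suc n) - c n *\<^sub>C h" "Y n - c n *\<^sub>C h"] by (simp add: distrib_right)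
      also have "\<dots> \<le> (B / cmod l + 1) * (M * \<sigma> ^ n * norm (Y n))"
        using B(1) by (intro mult_left_mono c) simp
      finally show ?thesis by (simp add: D_def mult_ac)
    qed
    have "norm (Y n) \<le> exp (\<Sum>k<n. D * \<sigma> ^ k) * norm y" for n
    proof (induction n)
      case 0 then show ?case by (simp add: Y_def scaleC_one)
    next
      case (Suc n)
      have "norm (Y (Suc n)) \<le> norm (Y n) + D * \<sigma> ^ n * norm (Y n)"
        using inc[of n] norm_triangle_ineq2[of "Y (Suc n)" "Y n"] by linarith
      also have "\<dots> = (1 + D * \<sigma> ^ n) * norm (Y n)" by (simp add: distrib_right)
      also have "\<dots> \<le> exp (D * \<sigma> ^ n) * (exp (\<Sum>k<n. D * \<sigma> ^ k) * norm y)"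
        by (intro mult_mono Suc.IH exp_ge_add_one_self) auto
      finally show ?case by (simp add: exp_add mult_ac)
    qed
    moreover have "exp (\<Sum>k<n. D * \<sigma> ^ k) \<le> E" for n
    proof -
      have "(\<Sum>k<n. \<sigma> ^ k) \<le> 1 / (1 - \<sigma>)"
        using sum_le_suminf[OF summable_geometric[of \<sigma>], of "{..<n}"] suminf_geometric[of \<sigma>] \<sigma> by simp
      from mult_left_mono[OF this D] show ?thesis
        by (simp add: E_def sum_distrib_left)
    qed
    ultimately have YE: "norm (Y n) \<le> E * norm y" for n
      by (meson mult_right_mono norm_ge_zero order.trans)
    have "norm (Y (Suc n) - Y n) \<le> (D * E * norm y) * \<sigma> ^ n" for n
      using inc[of n] mult_left_mono[OF YE[of n], of "D * \<sigma> ^ n"] D \<sigma> by (simp add: mult_ac)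
    then obtain z where z: "Y \<longlonglongrightarrow> z" "\<And>n. norm (Y n - z) \<le> (D * E * norm y) * \<sigma> ^ n / (1 - \<sigma>)"
      using convergent_of_geometric_increments[of Y] \<sigma> by (metis less_imp_le)
    \<comment> \<open>Identifies the limit of the rescaled orbit as a multiple of \<open>h\<close>,
      again without prior knowledge that the coefficients converge.\<close>
    have "(\<lambda>n. c n *\<^sub>C h - Y n) \<longlonglongrightarrow> 0"
    proof (rule Lim_null_comparison)
      have "norm (c n *\<^sub>C h - Y n) \<le> M * (E * norm y) * \<sigma> ^ n" for n
        using c[of n] mult_left_mono[OF YE[of n], of "M * \<sigma> ^ n"] M \<sigma> by (simp add: mult_ac norm_minus_commute)
      then show "\<forall>\<^sub>F n in sequentially. norm (c n *\<^sub>C h - Y n) \<le> M * (E * norm y) * \<sigma> ^ n" by simp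
      have "(\<lambda>n. M * (E * norm y) * \<sigma> ^ n) \<longlonglongrightarrow> M * (E * norm y) * 0"
        using \<sigma> by (intro tendsto_intros LIMSEQ_power_zero) simp
      then show "(\<lambda>n. M * (E * norm y) * \<sigma> ^ n) \<longlonglongrightarrow> 0" by simp
    qed
    from tendsto_add[OF this z(1)] have "(\<lambda>n. c n *\<^sub>C h) \<longlonglongrightarrow> z" by simp
    then obtain a where "z = a *\<^sub>C h" using limit_on_complex_line[OF _ h(2)] by metis
    with z(2) show ?thesis
      by (intro exI[of _ a]) (simp add: Y_def mult_ac)
  qed
  moreover have "0 \<le> D * E / (1 - \<sigma>)" using D \<sigma> by (simp add: E_def)
  ultimately show ?thesis by blast
qed

text \<open>By inner regularity a small multiple of any \<open>x\<close>, pushed forward by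
  \<open>T ^^ n0\<close>, is a difference \<open>y - x0\<close> of two nonzero cone vectors, to
  which the estimate on the cone applies. This covers \<open>n \<ge> n0\<close>; the finitely many
  smaller \<open>n\<close> are absorbed into the constant.\<close>

lemma orbit_asymptotics:
  assumes h: "h \<in> C" "norm h = 1" "l \<noteq> 0" "T h = l *\<^sub>C h"
    and reg: "inner_regular T n0 C"
  shows "\<exists>B\<ge>0. \<forall>x. \<exists>a. \<forall>n. norm (inverse l ^ n *\<^sub>C (T ^^ n) x - a *\<^sub>C h) \<le> B * \<sigma> ^ n * norm x"
proof -
  obtain B where B: "0 \<le> B"
    and orb: "\<And>y. y \<in> C - {0} \<Longrightarrow> \<exists>a. \<forall>n. norm (inverse l ^ n *\<^sub>C (T ^^ n) y - a *\<^sub>C h) \<le> B * \<sigma> ^ n * norm y"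
    using cone_orbit_asymptotics[OF h] by blast
  obtain r x0 where r: "r > 0" and x0r: "\<And>w. norm w < r \<Longrightarrow> x0 + (T ^^ n0) w \<in> C - {0}"
    using reg unfolding inner_regular_def image_subset_iff by (metis mem_ball_0)
  have x0: "x0 \<in> C - {0}"
    using x0r[of 0] r linear_0[OF bounded_linear.linear[OF T_bounded_linear(2)]] by simp
  obtain A where A: "0 \<le> A" "\<And>x. norm (T x) \<le> A * norm x" using T_norm_bound by blast
  have An: "norm ((T ^^ n) x) \<le> A ^ n * norm x" for n x
  proof (induction n)
    case (Suc n)
    have "norm ((T ^^ Suc n) x) \<le> A * norm ((T ^^ n) x)" using A(2) by simp
    also have "\<dots> \<le> A * (A ^ n * norm x)" using A(1) by (intro mult_left_mono Suc.IH)
    finally show ?case by simp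
  qed simp
  define B1 where "B1 = B * (2 * norm x0 + A ^ n0 * r)"
  define B2 where "B2 = inverse (cmod l) ^ n0 * B1 * inverse \<sigma> ^ n0 * (2 / r)"
  have B12: "0 \<le> B1" "0 \<le> B2" using B A r \<sigma> by (auto simp: B1_def B2_def)
  have large: "\<exists>a. \<forall>n\<ge>n0. norm (inverse l ^ n *\<^sub>C (T ^^ n) x - a *\<^sub>C h) \<le> B2 * \<sigma> ^ n * norm x" if "x \<noteq> 0" for x
  proof -
    \<comment> \<open>Scales \<open>x\<close> to norm \<open>r / 2\<close>, inside the open ball of
      inner regularity.\<close>
    define s where "s = r / (2 * norm x)"
    have s: "s > 0" using that r by (simp add: s_def)
    define w where "w = complex_of_real s *\<^sub>C x"
    have "norm w = s * norm x" using s by (simp add: w_def norm_scaleC)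
    then have w: "norm w = r / 2" using that by (simp add: s_def)
    define y where "y = x0 + (T ^^ n0) w"
    have y: "y \<in> C - {0}" unfolding y_def using w r by (intro x0r) simp
    have ny: "norm y \<le> norm x0 + A ^ n0 * r"
    proof -
      have "norm y \<le> norm x0 + norm ((T ^^ n0) w)" unfolding y_def by (rule norm_triangle_ineq)
      also have "norm ((T ^^ n0) w) \<le> A ^ n0 * norm w" by (rule An)
      also have "\<dots> \<le> A ^ n0 * r" using w r A by (intro mult_left_mono) auto
      finally show ?thesis by simp
    qed
    obtain a b where a: "\<And>n. norm (inverse l ^ n *\<^sub>C (T ^^ n) y - a *\<^sub>C h) \<le> B * \<sigma> ^ n * norm y"
      and b: "\<And>n. norm (inverse l ^ n *\<^sub>C (T ^^ n) x0 - b *\<^sub>C h) \<le> B * \<sigma> ^ n * norm x0"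
      using orb[OF y] orb[OF x0] by blast
    \<comment> \<open>The coefficients of \<open>y\<close> and \<open>x0\<close> are subtracted, the
      scaling by \<open>s\<close> is undone, and \<open>inverse l ^ n0\<close> accounts for the
      \<open>n0\<close> steps by which the orbit of \<open>x\<close> is ahead.\<close>
    define c where "c = inverse s * (inverse l ^ n0 * (a - b))"
    have "norm (inverse l ^ n *\<^sub>C (T ^^ n) x - c *\<^sub>C h) \<le> B2 * \<sigma> ^ n * norm x" if "n \<ge> n0" for n
    proof -
      define k where "k = n - n0"
      have k: "n = k + n0" using that by (simp add: k_def)
      have "(T ^^ k) y = (T ^^ k) x0 + complex_of_real s *\<^sub>C (T ^^ n) x"
        by (simp add: y_def w_def T_simps k funpow_add)
      then have "complex_of_real s *\<^sub>C (T ^^ n) x = (T ^^ k) y - (T ^^ k) x0"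
        by simp
      then have "(complex_of_real (inverse s) * complex_of_real s) *\<^sub>C (T ^^ n) x = complex_of_real (inverse s) *\<^sub>C ((T ^^ k) y - (T ^^ k) x0)"
        by (simp only: flip: scaleC_scaleC)
      then have Tn: "(T ^^ n) x = complex_of_real (inverse s) *\<^sub>C ((T ^^ k) y - (T ^^ k) x0)"
        using s by (simp add: scaleC_one flip: of_real_mult)
      have "inverse l ^ n *\<^sub>C (T ^^ n) x - c *\<^sub>C h = (complex_of_real (inverse s) * inverse l ^ n0) *\<^sub>C
          ((inverse l ^ k *\<^sub>C (T ^^ k) y - a *\<^sub>C h) - (inverse l ^ k *\<^sub>C (T ^^ k) x0 - b *\<^sub>C h))"
        unfolding Tn c_def
        by (simp add: k scaleC_scaleC complex_vector.scale_right_diff_distrib complex_vector.scale_left_diff_distrib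
            right_diff_distrib left_diff_distrib power_add mult_ac)
      then have "norm (inverse l ^ n *\<^sub>C (T ^^ n) x - c *\<^sub>C h) = inverse s * inverse (cmod l) ^ n0 *
          norm ((inverse l ^ k *\<^sub>C (T ^^ k) y - a *\<^sub>C h) - (inverse l ^ k *\<^sub>C (T ^^ k) x0 - b *\<^sub>C h))"
        using s by (simp add: norm_scaleC norm_mult norm_power norm_inverse)
      also have "\<dots> \<le> inverse s * inverse (cmod l) ^ n0 * (B1 * \<sigma> ^ k)"
      proof (intro mult_left_mono)
        have "B * \<sigma> ^ k * norm y \<le> B * \<sigma> ^ k * (norm x0 + A ^ n0 * r)"
          using B \<sigma> by (intro mult_left_mono ny) auto
        then show "norm ((inverse l ^ k *\<^sub>C (T ^^ k) y - a *\<^sub>C h) - (inverse l ^ k *\<^sub>C (T ^^ k) x0 - b *\<^sub>C h)) \<le> B1 * \<sigma> ^ k"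
          using norm_triangle_ineq4[of "inverse l ^ k *\<^sub>C (T ^^ k) y - a *\<^sub>C h" "inverse l ^ k *\<^sub>C (T ^^ k) x0 - b *\<^sub>C h"]
            a[of k] b[of k] by (simp add: B1_def algebra_simps)
      qed (use s in auto)
      also have "\<dots> = B2 * \<sigma> ^ n * norm x"
        using \<sigma> that by (simp add: B2_def k power_add s_def power_inverse mult_ac)
      finally show ?thesis .
    qed
    then show ?thesis by blast
  qed
  define \<tau> where "\<tau> = inverse (cmod l) * A"
  have \<tau>: "0 \<le> \<tau>" using A by (simp add: \<tau>_def)
  have \<tau>n: "norm (inverse l ^ n *\<^sub>C (T ^^ n) x) \<le> \<tau> ^ n * norm x" for n x
  proof -
    have "norm (inverse l ^ n *\<^sub>C (T ^^ n) x) = inverse (cmod l) ^ n * norm ((T ^^ n) x)"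
      by (simp add: norm_scaleC norm_power norm_inverse)
    also have "\<dots> \<le> inverse (cmod l) ^ n * (A ^ n * norm x)" by (intro mult_left_mono An) simp
    finally show ?thesis by (simp add: \<tau>_def power_mult_distrib)
  qed
  \<comment> \<open>For \<open>n < n0\<close> the vector is bounded by a power of
    \<open>\<tau>\<close> and the coefficient \<open>a\<close> by the estimate at \<open>n0\<close>.
    The factor \<open>inverse \<sigma> ^ n0\<close> compensates for \<open>\<sigma> ^ n\<close>,
    which is at least \<open>\<sigma> ^ n0\<close>.\<close>
  define B3 where "B3 = ((\<Sum>k\<le>n0. \<tau> ^ k) + B2 + \<tau> ^ n0) * inverse \<sigma> ^ n0"
  have B3: "0 \<le> B3" using \<tau> B12 \<sigma> by (simp add: B3_def sum_nonneg)
  have "\<exists>a. \<forall>n. norm (inverse l ^ n *\<^sub>C (T ^^ n) x - a *\<^sub>C h) \<le> (B2 + B3) * \<sigma> ^ n * norm x" for x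
  proof (cases "x = 0")
    case True
    then show ?thesis
      using linear_0[OF bounded_linear.linear[OF T_bounded_linear(2)]] by (intro exI[of _ 0]) simp
  next
    case False
    obtain a where a: "\<And>n. n \<ge> n0 \<Longrightarrow> norm (inverse l ^ n *\<^sub>C (T ^^ n) x - a *\<^sub>C h) \<le> B2 * \<sigma> ^ n * norm x"
      using large[OF False] by blast
    have "norm (inverse l ^ n *\<^sub>C (T ^^ n) x - a *\<^sub>C h) \<le> (B2 + B3) * \<sigma> ^ n * norm x" for n
    proof (cases "n \<ge> n0")
      case True
      show ?thesis using a[OF True] B3 \<sigma> by (simp add: distrib_right add_increasing2)
    next
      case False
      have "norm (a *\<^sub>C h) \<le> norm (inverse l ^ n0 *\<^sub>C (T ^^ n0) x - a *\<^sub>C h) + norm (inverse l ^ n0 *\<^sub>C (T ^^ n0) x)"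
        using norm_triangle_ineq4[of "inverse l ^ n0 *\<^sub>C (T ^^ n0) x" "inverse l ^ n0 *\<^sub>C (T ^^ n0) x - a *\<^sub>C h"] by simp
      also have "\<dots> \<le> B2 * norm x + \<tau> ^ n0 * norm x"
      proof (intro add_mono \<tau>n order.trans[OF a[OF order.refl]] mult_right_mono)
        show "B2 * \<sigma> ^ n0 \<le> B2" using B12 \<sigma> by (simp add: mult_left_le power_le_one)
      qed simp
      finally have "norm (inverse l ^ n *\<^sub>C (T ^^ n) x - a *\<^sub>C h) \<le> \<tau> ^ n * norm x + (B2 * norm x + \<tau> ^ n0 * norm x)"
        using norm_triangle_ineq4[of "inverse l ^ n *\<^sub>C (T ^^ n) x" "a *\<^sub>C h"] \<tau>n[of n x] by linarith
      also have "\<dots> = (\<tau> ^ n + B2 + \<tau> ^ n0) * norm x" by (simp add: distrib_right)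
      also have "\<dots> \<le> B3 * \<sigma> ^ n * norm x"
      proof (rule mult_right_mono)
        have "\<tau> ^ n \<le> (\<Sum>k\<le>n0. \<tau> ^ k)" using False \<tau> by (intro member_le_sum) auto
        then have "\<tau> ^ n + B2 + \<tau> ^ n0 \<le> B3 * \<sigma> ^ n0"
          using \<sigma> by (simp add: B3_def power_inverse mult.assoc)
        also have "\<dots> \<le> B3 * \<sigma> ^ n"
          using B3 \<sigma> False by (intro mult_left_mono power_decreasing) auto
        finally show "\<tau> ^ n + B2 + \<tau> ^ n0 \<le> B3 * \<sigma> ^ n" .
      qed simp
      also have "\<dots> \<le> (B2 + B3) * \<sigma> ^ n * norm x"
        using B12 \<sigma> by (intro mult_right_mono) auto
      finally show ?thesis .
    qed
    then show ?thesis by blast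
  qed
  then show ?thesis using B12 B3 by (intro exI[of _ "B2 + B3"]) auto
qed

lemma spectral_gap:
  assumes x: "x \<in> C - {0}" and reg: "inner_regular T n0 C"
  shows "has_spectral_gap T"
proof -
  obtain h l where h: "h \<in> C" "norm h = 1" "l \<noteq> 0" "T h = l *\<^sub>C h"
    using eigenvector_exists[OF x] .
  obtain B where B: "0 \<le> B"
    and "\<forall>x. \<exists>a. \<forall>n. norm (inverse l ^ n *\<^sub>C (T ^^ n) x - a *\<^sub>C h) \<le> B * \<sigma> ^ n * norm x"
    using orbit_asymptotics[OF h reg] by blast
  then obtain \<nu> where \<nu>: "\<And>x n. norm (inverse l ^ n *\<^sub>C (T ^^ n) x - \<nu> x *\<^sub>C h) \<le> B * \<sigma> ^ n * norm x"
    by metis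
  have lim: "(\<lambda>n. inverse l ^ n *\<^sub>C (T ^^ n) x) \<longlonglongrightarrow> \<nu> x *\<^sub>C h" for x
  proof (rule LIM_zero_cancel, rule Lim_null_comparison)
    show "\<forall>\<^sub>F n in sequentially. norm (inverse l ^ n *\<^sub>C (T ^^ n) x - \<nu> x *\<^sub>C h) \<le> B * \<sigma> ^ n * norm x"
      using \<nu> by simp
    have "(\<lambda>n. B * \<sigma> ^ n * norm x) \<longlonglongrightarrow> B * 0 * norm x"
      using \<sigma> by (intro tendsto_intros LIMSEQ_power_zero) simp
    then show "(\<lambda>n. B * \<sigma> ^ n * norm x) \<longlonglongrightarrow> 0" by simp
  qed
  have h0: "h \<noteq> 0" using h(2) by auto
  \<comment> \<open>\<open>\<nu>\<close> comes from pointwise choice; uniqueness of limits yields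
    its linearity, its compatibility with \<open>T\<close> and its normalization.\<close>
  have uniq: "\<nu> x = a" if "(\<lambda>n. inverse l ^ n *\<^sub>C (T ^^ n) x) \<longlonglongrightarrow> a *\<^sub>C h" for x a
    using LIMSEQ_unique[OF lim that] h0 by simp
  have Tnh: "(T ^^ n) h = l ^ n *\<^sub>C h" for n
    by (induction n) (simp_all add: T_simps h(4) scaleC_scaleC scaleC_one mult.commute)
  have \<nu>_add: "\<nu> (x + y) = \<nu> x + \<nu> y" for x y
    using tendsto_add[OF lim[of x] lim[of y]]
    by (intro uniq) (simp add: T_simps scaleC_add_left scaleC_add_right)
  have \<nu>_scale: "\<nu> (c *\<^sub>C x) = c * \<nu> x" for c x
    using scaleC.tendsto[OF tendsto_const[of c] lim[of x]]
    by (intro uniq) (simp add: T_simps scaleC_scaleC mult.commute)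
  have \<nu>_T: "\<nu> (T x) = l * \<nu> x" for x
    using bounded_linear.tendsto[OF T_bounded_linear(1) lim[of x]]
    by (intro uniq) (simp add: T_simps funpow_swap1 h(4) scaleC_scaleC mult.commute)
  have \<nu>_h: "\<nu> h = 1"
    using h(3) by (intro uniq) (simp add: Tnh scaleC_scaleC flip: power_mult_distrib)
  show ?thesis
  proof (rule has_spectral_gapI[OF T h(4,2) \<nu>_add \<nu>_scale \<nu>_T \<nu>_h])
    fix x
    have "norm (\<nu> x *\<^sub>C h) \<le> norm (x - \<nu> x *\<^sub>C h) + norm x"
      using norm_triangle_ineq4[of x "x - \<nu> x *\<^sub>C h"] by simp
    \<comment> \<open>Continuity of \<open>\<nu>\<close> is the case \<open>n = 0\<close> of the
      asymptotic estimate.\<close>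
    then show "cmod (\<nu> x) \<le> (B + 1) * norm x"
      using \<nu>[of 0 x] h(2) by (simp add: norm_scaleC scaleC_one distrib_right)
  next
    show "0 \<le> \<sigma> * cmod l" "\<sigma> * cmod l < cmod l" using \<sigma> h(3) by auto
  next
    fix n x
    have "(T ^^ n) (x - \<nu> x *\<^sub>C h) = (T ^^ n) x - (\<nu> x * l ^ n) *\<^sub>C h"
      by (simp add: linear_diff[OF bounded_linear.linear[OF T_bounded_linear(2)]] T_simps Tnh scaleC_scaleC)
    also have "\<dots> = l ^ n *\<^sub>C (inverse l ^ n *\<^sub>C (T ^^ n) x - \<nu> x *\<^sub>C h)"
      using h(3) by (simp add: complex_vector.scale_right_diff_distrib scaleC_scaleC scaleC_one mult.commute flip: power_mult_distrib)
    finally have "norm ((T ^^ n) (x - \<nu> x *\<^sub>C h)) = cmod l ^ n * norm (inverse l ^ n *\<^sub>C (T ^^ n) x - \<nu> x *\<^sub>C h)"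
      by (simp add: norm_scaleC norm_power)
    also have "\<dots> \<le> cmod l ^ n * (B * \<sigma> ^ n * norm x)" by (intro mult_left_mono \<nu>) simp
    finally show "norm ((T ^^ n) (x - \<nu> x *\<^sub>C h)) \<le> B * (\<sigma> * cmod l) ^ n * norm x"
      by (simp add: power_mult_distrib mult_ac)
  qed
qed

end

theorem theorem3p7:
  fixes T :: "'a::complex_banach \<Rightarrow> 'a" and C :: "'a set" and K :: real and n\<^sub>0 :: nat
  assumes "bounded_clinear T"
    and "C_cone C"
    and "1 \<le> K"
    and "bounded_sectional_aperture K C"
    and "inner_regular T n\<^sub>0 C"
    and "strict_cone_contraction T C"
  shows "has_spectral_gap T"
proof -
  have T_C: "T ` (C - {0}) \<subseteq> C - {0}" and "cone_diam C (T ` (C - {0})) < \<infinity>"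
    using assms(6) by (auto simp: strict_cone_contraction_def)
  then obtain \<Delta> where \<Delta>: "cone_diam C (T ` (C - {0})) = ennreal \<Delta>" "0 \<le> \<Delta>"
    by (metis ennreal_cases infinity_ennreal_def less_irrefl)
  \<comment> \<open>The added 1 makes the distance bound strict, as needed to pick a path from the
    infimum, and keeps the contraction factor positive when the diameter is 0.\<close>
  define L where "L = \<Delta> + 1"
  have L: "0 < L" "ennreal \<Delta> < ennreal L" using \<Delta> by (auto simp: L_def ennreal_lessI)
  have dist: "cone_dist C a b < ennreal L" if "a \<in> T ` (C - {0})" "b \<in> T ` (C - {0})" for a b
  proof -
    have "cone_dist C a b \<le> cone_diam C (T ` (C - {0}))"
      unfolding cone_diam_def using that by (meson SUP_upper2 order.refl)
    then show ?thesis using \<Delta>(1) L(2) by simp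
  qed
  have C: "c *\<^sub>C x \<in> C" if "x \<in> C" for c x
    using assms(2) that unfolding C_cone_def by blast
  have "closed C" using assms(2) by (simp add: C_cone_def)
  obtain x where x: "x \<noteq> 0" "cspan {x} \<subseteq> C" using assms(2) by (auto simp: C_cone_def)
  then have xC: "x \<in> C - {0}" using complex_vector.span_base[of x "{x}"] by auto
  interpret collinear_iterates T C "(exp L - 1) / (exp L + 1)" "2 * K"
  proof
    show "0 < (exp L - 1) / (exp L + 1)" using L(1) by (simp add: add_pos_pos)
    have "0 < exp L + 1" by (simp add: add_pos_pos)
    then show "(exp L - 1) / (exp L + 1) < 1" by simp
    show "\<exists>c. norm ((T ^^ n) a - c *\<^sub>C (T ^^ n) b)
           \<le> 2 * K * ((exp L - 1) / (exp L + 1)) ^ n * norm ((T ^^ n) a)"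
      if "a \<in> C - {0}" "b \<in> C - {0}" for a b n
      using cone_iterates_collinear[OF assms(1) T_C dist _ C assms(4,3) that] L(1) by simp
  qed (use assms(1) \<open>closed C\<close> C T_C in auto)
  show ?thesis using spectral_gap[OF xC assms(5)] .
qed

end
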